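(* Assume that \[ \sup_{x\in S} q_n(x) = o(n/m_n), \qquad n\to\infty . \] Then, as $n\to\infty$, the OLSMC estimator $\hat\mu_n^{\mathrm{OLS}}$ is well-defined with probability tending to one and \[ \frac{\sqrt n}{\sigma_n}\left(\hat\mu_n^{\mathrm{OLS}}-\mu_n\right) = \frac{\sqrt n}{\sigma_n}\,P_n(\varepsilon_n) + o_{\mathbb P}(1) = O_{\mathbb P}(1). \] In particular, $\hat\mu_n^{\mathrm{OLS}}-\mu_n = O_{\mathbb P}(\sigma_n/\sqrt n)$ as $n\to\infty$.
   Context: Let $(S,\mathcal S,P)$ be a probability space; for a (scalar-, vector- or matrix-valued) function $g$ on $S$ write $P(g)=\int_S g\,\mathrm dP$ (componentwise). For each $n$, $X_1,\dots,X_n$ is an independent random sample from $P$ defined on a probability space $(\Omega,\mathcal A,\mathbb P)$, and $P_n(g)=n^{-1}\sum_{i=1}^n g(X_i)$. A prime denotes transposition. Let $(m_n)$ be a sequence of positive integers with $m_n\to\infty$. For each $n$ let $h_n=(h_{n,1},\dots,h_{n,m_n})'$ be a column vector of real functions (control functions) $h_{n,j}\in L^2(P)$ with $P(h_{n,j})=0$ for all $j$, such that $h_{n,1},\dots,h_{n,m_n}$ are linearly independent in $L^2(P)$; equivalently, the $m_n\times m_n$ Gram matrix $P(h_nh_n')=(P(h_{n,j}h_{n,k}))_{j,k}$ is invertible. The leverage function is $q_n(x)=h_n(x)'\,P(h_nh_n')^{-1}\,h_n(x)$, $x\in S$. For each $n$ let $f_n\in L^2(P)$ be a real function (integrand) and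 $\mu_n=P(f_n)$. Write $f_n=\mu_n+\beta_n'h_n+\varepsilon_n$, where $\beta_n\in\mathbb R^{m_n}$ is determined by $P(\varepsilon_nh_{n,j})=0$ for all $j=1,\dots,m_n$. Then $P(\varepsilon_n)=0$. Let $\sigma_n^2=P(\varepsilon_n^2)$ and assume $\sigma_n^2>0$ for all $n$ ($\sigma_n>0$ is its square root). The ordinary least squares Monte Carlo (OLSMC) estimator $\hat\mu_n^{\mathrm{OLS}}$ of $\mu_n$ is the $\alpha$-component of a minimizer of $\sum_{i=1}^n\{f_n(X_i)-\alpha-\beta'h_n(X_i)\}^2$ over $(\alpha,\beta)\in\mathbb R\times\mathbb R^{m_n}$. It is well-defined when this $\alpha$-component is unique, i.e. when the vector $1_n=(1,\dots,1)'\in\mathbb R^n$ is not in the column space of the $n\times m_n$ matrix $(h_{n,j}(X_i))_{i,j}$; its value on the complementary event (say $0$) is immaterial for the asymptotic statements. $O_{\mathbb P}$ and $o_{\mathbb P}$ denote the usual stochastic order symbols. *)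

theory Defs
  imports
    "HOL-Probability.Probability"
    "Jordan_Normal_Form.Gauss_Jordan_Elimination"
begin

unbundle no vec_syntax and no inner_syntax
hide_const (open) Finite_Cartesian_Product.vec Determinants.det Finite_Cartesian_Product.mat

section \<open>Stochastic order symbols\<close>

text \<open>
  Measurability is part of both definitions, because \<^const>\<open>measure\<close> returns the
  junk value 0 on non-measurable sets.
\<close>

definition little_oP :: "'w measure \<Rightarrow> (nat \<Rightarrow> 'w \<Rightarrow> real) \<Rightarrow> (nat \<Rightarrow> real) \<Rightarrow> bool" where
  "little_oP M Z r \<longleftrightarrow>
     (\<forall>n. Z n \<in> borel_measurable M) \<and>
     (\<forall>\<delta>>0. (\<lambda>n. measure M {\<omega> \<in> space M. \<bar>Z n \<omega>\<bar> > \<delta> * \<bar>r n\<bar>}) \<longlonglongrightarrow> 0)"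

definition big_OP :: "'w measure \<Rightarrow> (nat \<Rightarrow> 'w \<Rightarrow> real) \<Rightarrow> (nat \<Rightarrow> real) \<Rightarrow> bool" where
  "big_OP M Z r \<longleftrightarrow>
     (\<forall>n. Z n \<in> borel_measurable M) \<and>
     (\<forall>\<delta>>0. \<exists>C. \<forall>\<^sub>F n in sequentially.
        measure M {\<omega> \<in> space M. \<bar>Z n \<omega>\<bar> > C * \<bar>r n\<bar>} < \<delta>)"

section \<open>Control functions and integrands\<close>

definition L2 :: "'s measure \<Rightarrow> ('s \<Rightarrow> real) set" where
  "L2 P = {g \<in> borel_measurable P. integrable P (\<lambda>x. (g x)\<^sup>2)}"

text \<open>
  A family \<open>h\<close> of \<open>m\<close> functions is indexed by \<open>j < m\<close>. Since elements of \<open>L\<^sup>2(P)\<close> are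
  classes of functions, a linear combination vanishes there iff it is 0 almost everywhere.
\<close>

definition lin_indep_L2 :: "'s measure \<Rightarrow> nat \<Rightarrow> (nat \<Rightarrow> 's \<Rightarrow> real) \<Rightarrow> bool" where
  "lin_indep_L2 P m h \<longleftrightarrow>
     (\<forall>c :: nat \<Rightarrow> real. (AE x in P. (\<Sum>j<m. c j * h j x) = 0) \<longrightarrow> (\<forall>j<m. c j = 0))"

definition control_vec :: "nat \<Rightarrow> (nat \<Rightarrow> 's \<Rightarrow> real) \<Rightarrow> 's \<Rightarrow> real vec" where
  "control_vec m h x = vec m (\<lambda>j. h j x)"

definition gram :: "'s measure \<Rightarrow> nat \<Rightarrow> (nat \<Rightarrow> 's \<Rightarrow> real) \<Rightarrow> real mat" where
  "gram P m h = mat m m (\<lambda>(j, k). \<integral>x. h j x * h k x \<partial>P)"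

definition leverage :: "'s measure \<Rightarrow> nat \<Rightarrow> (nat \<Rightarrow> 's \<Rightarrow> real) \<Rightarrow> 's \<Rightarrow> real" where
  "leverage P m h x =
     control_vec m h x \<bullet> (the (mat_inverse (gram P m h)) *\<^sub>v control_vec m h x)"

definition proj_coef ::
  "'s measure \<Rightarrow> nat \<Rightarrow> (nat \<Rightarrow> 's \<Rightarrow> real) \<Rightarrow> ('s \<Rightarrow> real) \<Rightarrow> real vec" where
  "proj_coef P m h f =
     (THE b. b \<in> carrier_vec m \<and>
        (\<forall>j<m. (\<integral>x. (f x - integral\<^sup>L P f - b \<bullet> control_vec m h x) * h j x \<partial>P) = 0))"

definition resid ::
  "'s measure \<Rightarrow> nat \<Rightarrow> (nat \<Rightarrow> 's \<Rightarrow> real) \<Rightarrow> ('s \<Rightarrow> real) \<Rightarrow> 's \<Rightarrow> real" where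
  "resid P m h f x = f x - integral\<^sup>L P f - proj_coef P m h f \<bullet> control_vec m h x"

definition resid_sd ::
  "'s measure \<Rightarrow> nat \<Rightarrow> (nat \<Rightarrow> 's \<Rightarrow> real) \<Rightarrow> ('s \<Rightarrow> real) \<Rightarrow> real" where
  "resid_sd P m h f = sqrt (\<integral>x. (resid P m h f x)\<^sup>2 \<partial>P)"

section \<open>Estimators, as functions of the sample points \<open>x 0, \<dots>, x (n - 1)\<close>\<close>

definition emp_mean :: "nat \<Rightarrow> (nat \<Rightarrow> 's) \<Rightarrow> ('s \<Rightarrow> real) \<Rightarrow> real" where
  "emp_mean n x g = (\<Sum>i<n. g (x i)) / real n"

definition ols_loss ::
  "nat \<Rightarrow> nat \<Rightarrow> (nat \<Rightarrow> 's \<Rightarrow> real) \<Rightarrow> ('s \<Rightarrow> real) \<Rightarrow> (nat \<Rightarrow> 's) \<Rightarrow> real \<Rightarrow> real vec \<Rightarrow> real" where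
  "ols_loss n m h f x \<alpha> b = (\<Sum>i<n. (f (x i) - \<alpha> - b \<bullet> control_vec m h (x i))\<^sup>2)"

definition ols_minimizer ::
  "nat \<Rightarrow> nat \<Rightarrow> (nat \<Rightarrow> 's \<Rightarrow> real) \<Rightarrow> ('s \<Rightarrow> real) \<Rightarrow> (nat \<Rightarrow> 's) \<Rightarrow> real \<Rightarrow> real vec \<Rightarrow> bool" where
  "ols_minimizer n m h f x \<alpha> b \<longleftrightarrow>
     b \<in> carrier_vec m \<and>
     (\<forall>\<alpha>'. \<forall>b' \<in> carrier_vec m. ols_loss n m h f x \<alpha> b \<le> ols_loss n m h f x \<alpha>' b')"

definition olsmc_well_defined ::
  "nat \<Rightarrow> nat \<Rightarrow> (nat \<Rightarrow> 's \<Rightarrow> real) \<Rightarrow> ('s \<Rightarrow> real) \<Rightarrow> (nat \<Rightarrow> 's) \<Rightarrow> bool" where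
  "olsmc_well_defined n m h f x \<longleftrightarrow> (\<exists>!\<alpha>. \<exists>b. ols_minimizer n m h f x \<alpha> b)"

definition olsmc ::
  "nat \<Rightarrow> nat \<Rightarrow> (nat \<Rightarrow> 's \<Rightarrow> real) \<Rightarrow> ('s \<Rightarrow> real) \<Rightarrow> (nat \<Rightarrow> 's) \<Rightarrow> real" where
  "olsmc n m h f x =
     (if olsmc_well_defined n m h f x then THE \<alpha>. \<exists>b. ols_minimizer n m h f x \<alpha> b else 0)"

end

theory Submission
  imports Defs "Jordan_Normal_Form.Determinant"
begin

text \<open>
  Both \<open>L\<^sup>2(P)\<close> and the sample carry a semi-inner product on functions, and the proof compares the two
  on the span of the controls. Passing to controls \<open>k\<close> that are orthonormal in \<open>L\<^sup>2(P)\<close> changes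
  neither the regression nor the leverage, which becomes \<open>q = \<Sum>\<^sub>j k\<^sub>j\<^sup>2\<close>
  (\<open>orthonormal_controls\<close>, \<open>leverage_orthonormal\<close>). Let \<open>K\<close> bound \<open>q\<close>. Sample means have variance at most
  \<open>P(g\<^sup>2)/n\<close>, so the following three squared distances have small expectation, each computed by
  summing squares of products of the \<open>k\<^sub>j\<close> back to \<open>q\<close>:

    \<^item> the sample Gram matrix \<open>P\<^sub>n(k k')\<close> to the identity: at most \<open>P(q\<^sup>2)/n \<le> K m/n\<close>;
    \<^item> the sample means \<open>P\<^sub>n(k)\<close> to 0: at most \<open>P(q)/n = m/n\<close>;
    \<^item> the sample cross moments \<open>P\<^sub>n(k \<epsilon>)\<close> to 0: at most \<open>P(q \<epsilon>\<^sup>2)/n \<le> K \<sigma>\<^sup>2/n\<close>.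

  Since \<open>m = P(q) \<le> K\<close>, the first two are at most \<open>\<rho> = K m/n\<close>, which the hypothesis sends to 0, and the
  product of the last two is at most \<open>\<rho> \<sigma>\<^sup>2/n\<close>.

  On the event that the first two are small, the normal equations alone determine the intercept up to a
  small error (\<open>normal_equations_perturbation\<close>): with \<open>d\<close> the error of the estimator and \<open>w = P\<^sub>n(\<epsilon>)\<close>,
  the difference \<open>d - w\<close> is the pairing of the coefficient error with \<open>P\<^sub>n(k)\<close>, and the coefficient error
  is controlled by \<open>P\<^sub>n(k \<epsilon>)\<close> and \<open>d P\<^sub>n(k)\<close>. Hence \<open>\<bar>d - w\<bar>\<close> is of the order of the product of two small
  norms, that is \<open>\<surd>\<rho> \<sigma>/\<surd>n\<close>, whereas \<open>w\<close> is of order \<open>\<sigma>/\<surd>n\<close>. The same perturbation bound, applied to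
  the zero integrand, shows that the estimator is well-defined there. Markov's inequality turns this into
  explicit bounds for every sample size (\<open>finite_sample_bounds\<close>), from which the limits follow.

  The stochastic order symbols also require the estimator to be measurable, on degenerate samples too. This
  comes from the closed form \<open>\<langle>r, f\<rangle> / \<langle>r, r\<rangle>\<close> of the intercept, where \<open>r\<close> is the residual of the constant 1
  after regression on the controls (\<open>ols_closed_form\<close>): \<open>r\<close> is produced by the Gram-Schmidt recursion and so
  depends measurably on the sample, and division by zero returns exactly the default value of the estimator.
\<close>

section \<open>Residuals with respect to a semi-inner product\<close>

text \<open>
  One step of modified Gram-Schmidt per vector. Because \<open>x / 0 = 0\<close>, a vector that depends on the earlier
  ones is skipped. An explicit recursion is used so that residuals depend measurably on any parameters on
  which \<open>B\<close> depends measurably.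
\<close>

primrec residual ::
  "(('s \<Rightarrow> real) \<Rightarrow> ('s \<Rightarrow> real) \<Rightarrow> real) \<Rightarrow> (nat \<Rightarrow> 's \<Rightarrow> real) \<Rightarrow> nat \<Rightarrow> ('s \<Rightarrow> real) \<Rightarrow> 's \<Rightarrow> real"
where
  "residual B z 0 u = u"
| "residual B z (Suc m) u =
     (\<lambda>x. residual B z m u x
        - B (residual B z m u) (residual B z m (z m)) / B (residual B z m (z m)) (residual B z m (z m))
          * residual B z m (z m) x)"

lemma residual_eq_minus_combination:
  "\<exists>c. residual B z m u = (\<lambda>x. u x - (\<Sum>j<m. c j * z j x))"
proof (induction m arbitrary: u)
  case 0
  show ?case by simp
next
  case (Suc m)
  obtain c where c: "residual B z m u = (\<lambda>x. u x - (\<Sum>j<m. c j * z j x))"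
    using Suc by blast
  obtain d where d: "residual B z m (z m) = (\<lambda>x. z m x - (\<Sum>j<m. d j * z j x))"
    using Suc by blast
  define t where
    "t = B (residual B z m u) (residual B z m (z m)) / B (residual B z m (z m)) (residual B z m (z m))"
  have "residual B z (Suc m) u x = u x - (\<Sum>j<Suc m. (if j = m then t else c j - t * d j) * z j x)" for x
  proof -
    have "residual B z (Suc m) u x = residual B z m u x - t * residual B z m (z m) x"
      by (simp add: t_def)
    also have "\<dots> = u x - ((\<Sum>j<m. (c j - t * d j) * z j x) + t * z m x)"
      by (simp add: c d algebra_simps sum_subtractf sum_distrib_left)
    also have "(\<Sum>j<m. (c j - t * d j) * z j x)
        = (\<Sum>j<m. (if j = m then t else c j - t * d j) * z j x)"
      by (intro sum.cong) auto
    finally show ?thesis by simp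
  qed
  then show ?case
    by (intro exI[of _ "\<lambda>j. if j = m then t else c j - t * d j"] ext)
qed

locale semi_inner_product =
  fixes V :: "('s \<Rightarrow> real) set" and B :: "('s \<Rightarrow> real) \<Rightarrow> ('s \<Rightarrow> real) \<Rightarrow> real"
  assumes minus_scaled_closed: "u \<in> V \<Longrightarrow> v \<in> V \<Longrightarrow> (\<lambda>x. u x - c * v x) \<in> V"
    and minus_scaled: "u \<in> V \<Longrightarrow> v \<in> V \<Longrightarrow> w \<in> V \<Longrightarrow> B (\<lambda>x. u x - c * v x) w = B u w - c * B v w"
    and commute: "u \<in> V \<Longrightarrow> v \<in> V \<Longrightarrow> B u v = B v u"
    and nonneg: "u \<in> V \<Longrightarrow> 0 \<le> B u u"
begin

text \<open>
  The degenerate case of Cauchy-Schwarz: otherwise \<open>B (u - t v) (u - t v)\<close> would be a nonconstant affine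
  function of \<open>t\<close>, hence somewhere negative.
\<close>

lemma null_orthogonal:
  assumes "u \<in> V" "v \<in> V" "B v v = 0"
  shows "B u v = 0"
proof (rule ccontr)
  assume nz: "B u v \<noteq> 0"
  define t where "t = (B u u + 1) / (2 * B u v)"
  define w where "w = (\<lambda>x. u x - t * v x)"
  have w: "w \<in> V" unfolding w_def by (intro minus_scaled_closed assms)
  have "B w w = B u w - t * B v w"
    unfolding w_def by (rule minus_scaled) (use assms w w_def in auto)
  also have "B u w = B u u - t * B u v"
    using minus_scaled[of u v u t] assms w commute[of u w] commute[of u v] by (simp add: w_def)
  also have "B v w = B u v"
    using minus_scaled[of u v v t] assms w commute[of v w] by (simp add: w_def)
  finally have "B w w = -1" using nz by (simp add: t_def field_simps)
  with nonneg[OF w] show False by simp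
qed

lemma combination:
  fixes m :: nat
  assumes "u \<in> V" "w \<in> V" "\<And>j. j < m \<Longrightarrow> z j \<in> V"
  shows "(\<lambda>x. u x - (\<Sum>j<m. c j * z j x)) \<in> V"
    and "B (\<lambda>x. u x - (\<Sum>j<m. c j * z j x)) w = B u w - (\<Sum>j<m. c j * B (z j) w)"
proof -
  have "(\<lambda>x. u x - (\<Sum>j<m. c j * z j x)) \<in> V \<and>
      B (\<lambda>x. u x - (\<Sum>j<m. c j * z j x)) w = B u w - (\<Sum>j<m. c j * B (z j) w)"
    using assms(3)
  proof (induct m)
    case 0
    show ?case using assms by simp
  next
    case (Suc m)
    have eq: "(\<lambda>x. u x - (\<Sum>j<Suc m. c j * z j x))
        = (\<lambda>x. (\<lambda>x. u x - (\<Sum>j<m. c j * z j x)) x - c m * z m x)"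
      by (simp add: algebra_simps)
    show ?case
      unfolding eq using Suc assms(2) by (subst minus_scaled) (auto intro!: minus_scaled_closed)
  qed
  then show "(\<lambda>x. u x - (\<Sum>j<m. c j * z j x)) \<in> V"
    and "B (\<lambda>x. u x - (\<Sum>j<m. c j * z j x)) w = B u w - (\<Sum>j<m. c j * B (z j) w)"
    by auto
qed

lemma residual_closed:
  assumes "u \<in> V" "\<And>j. j < m \<Longrightarrow> z j \<in> V"
  shows "residual B z m u \<in> V"
  using residual_eq_minus_combination[of B z m u] combination(1)[OF assms(1) assms(1), of m z] assms(2)
  by auto

text \<open>
  For independent \<open>z\<close> this is the usual Gram-Schmidt computation. If the residual of \<open>z m\<close> is null, then
  Cauchy-Schwarz makes it orthogonal to everything, and skipping it loses nothing.
\<close>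

lemma residual_orthogonal:
  assumes "u \<in> V" "\<And>j. j < m \<Longrightarrow> z j \<in> V" "j < m"
  shows "B (residual B z m u) (z j) = 0"
  using assms
proof (induction m arbitrary: u j)
  case 0
  then show ?case by simp
next
  case (Suc m)
  define r where "r = residual B z m (z m)"
  define s where "s = residual B z m u"
  have zV: "z i \<in> V" if "i \<le> m" for i using Suc.prems that by auto
  have r: "r \<in> V" and s: "s \<in> V"
    unfolding r_def s_def by (intro residual_closed zV Suc.prems; simp)+
  have orth: "B r (z i) = 0" "B s (z i) = 0" if "i < m" for i
    unfolding r_def s_def using that zV Suc.prems by (auto intro!: Suc.IH)
  \<comment> \<open>A vector orthogonal to the earlier \<open>z i\<close> does not distinguish \<open>z m\<close> from its residual.\<close>
  have zm: "B v (z m) = B v r" if "v \<in> V" "\<And>i. i < m \<Longrightarrow> B v (z i) = 0" for v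
  proof -
    obtain c where c: "r = (\<lambda>x. z m x - (\<Sum>j<m. c j * z j x))"
      using residual_eq_minus_combination unfolding r_def by blast
    have "B v r = B r v" using that r by (intro commute)
    also have "\<dots> = B (z m) v - (\<Sum>j<m. c j * B (z j) v)"
      unfolding c using that zV by (intro combination) auto
    also have "(\<Sum>j<m. c j * B (z j) v) = 0"
      using that zV commute[of v] by (intro sum.neutral) auto
    finally show ?thesis using that zV commute[of v "z m"] by auto
  qed
  have step: "B (residual B z (Suc m) u) (z i) = B s (z i) - B s r / B r r * B r (z i)" if "i \<le> m" for i
  proof -
    have "residual B z (Suc m) u = (\<lambda>x. s x - B s r / B r r * r x)"
      by (simp add: r_def s_def)
    then show ?thesis using minus_scaled[OF s r zV[OF that]] by (simp only:)
  qed
  show ?case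
  proof (cases "j = m")
    case True
    have "B (residual B z (Suc m) u) (z m) = B s r - B s r / B r r * B r r"
      using step[of m] zm[OF s] zm[OF r] orth by simp
    also have "\<dots> = 0"
      using null_orthogonal[OF s r] by auto
    finally show ?thesis using True by simp
  next
    case False
    then show ?thesis using step[of j] orth[of j] Suc.prems by simp
  qed
qed

end

section \<open>The least squares problem on a fixed sample\<close>

lemma scalar_prod_control_vec: "b \<bullet> control_vec m h x = (\<Sum>j<m. b $ j * h j x)"
  by (simp add: scalar_prod_def control_vec_def lessThan_atLeast0)

definition normal_equations ::
  "nat \<Rightarrow> nat \<Rightarrow> (nat \<Rightarrow> 's \<Rightarrow> real) \<Rightarrow> ('s \<Rightarrow> real) \<Rightarrow> (nat \<Rightarrow> 's) \<Rightarrow> real \<Rightarrow> real vec \<Rightarrow> bool"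
where
  "normal_equations n m h f x \<alpha> b \<longleftrightarrow>
     b \<in> carrier_vec m \<and>
     (\<Sum>i<n. f (x i) - \<alpha> - b \<bullet> control_vec m h (x i)) = 0 \<and>
     (\<forall>j<m. (\<Sum>i<n. (f (x i) - \<alpha> - b \<bullet> control_vec m h (x i)) * h j (x i)) = 0)"

text \<open>
  Pythagoras: the residual of a solution is orthogonal to every change of the fitted values.
\<close>

lemma ols_loss_normal_equations:
  assumes "normal_equations n m h f x \<alpha> b"
  shows "ols_loss n m h f x \<alpha>' b' =
    ols_loss n m h f x \<alpha> b + (\<Sum>i<n. (\<alpha> - \<alpha>' + (\<Sum>j<m. (b $ j - b' $ j) * h j (x i)))\<^sup>2)"
proof -
  define e where "e i = f (x i) - \<alpha> - b \<bullet> control_vec m h (x i)" for i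
  define d where "d i = \<alpha> - \<alpha>' + (\<Sum>j<m. (b $ j - b' $ j) * h j (x i))" for i
  have orth: "(\<Sum>i<n. e i) = 0" "\<And>j. j < m \<Longrightarrow> (\<Sum>i<n. e i * h j (x i)) = 0"
    using assms by (auto simp: normal_equations_def e_def)
  have "(\<Sum>i<n. e i * d i)
      = (\<alpha> - \<alpha>') * (\<Sum>i<n. e i) + (\<Sum>i<n. \<Sum>j<m. (b $ j - b' $ j) * (e i * h j (x i)))"
    by (simp add: d_def sum_distrib_left distrib_left sum.distrib mult_ac)
  also have "(\<Sum>i<n. \<Sum>j<m. (b $ j - b' $ j) * (e i * h j (x i)))
      = (\<Sum>j<m. (b $ j - b' $ j) * (\<Sum>i<n. e i * h j (x i)))"
    by (subst sum.swap) (simp add: sum_distrib_left)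
  also have "\<dots> = 0" by (intro sum.neutral) (simp add: orth)
  finally have cross: "(\<Sum>i<n. e i * d i) = 0" by (simp add: orth)
  have "ols_loss n m h f x \<alpha>' b' = (\<Sum>i<n. (e i + d i)\<^sup>2)"
    unfolding ols_loss_def
  proof (intro sum.cong refl)
    fix i
    have "f (x i) - \<alpha>' - b' \<bullet> control_vec m h (x i) = e i + d i"
      by (simp add: e_def d_def scalar_prod_control_vec algebra_simps sum_subtractf)
    then show "(f (x i) - \<alpha>' - b' \<bullet> control_vec m h (x i))\<^sup>2 = (e i + d i)\<^sup>2"
      by simp
  qed
  also have "\<dots> = (\<Sum>i<n. (e i)\<^sup>2 + (d i)\<^sup>2 + 2 * (e i * d i))"
    by (simp add: power2_sum mult.assoc)
  also have "\<dots> = (\<Sum>i<n. (e i)\<^sup>2) + (\<Sum>i<n. (d i)\<^sup>2)"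
    by (simp add: sum.distrib cross flip: sum_distrib_left)
  finally show ?thesis by (simp add: ols_loss_def e_def d_def)
qed

lemma ols_minimizer_if_normal_equations:
  assumes "normal_equations n m h f x \<alpha> b"
  shows "ols_minimizer n m h f x \<alpha> b"
proof -
  have "ols_loss n m h f x \<alpha> b \<le> ols_loss n m h f x \<alpha>' b'" for \<alpha>' b'
    by (subst ols_loss_normal_equations[OF assms, of \<alpha>' b']) (simp add: sum_nonneg)
  then show ?thesis
    using assms by (simp add: ols_minimizer_def normal_equations_def)
qed

abbreviation sample_product :: "nat \<Rightarrow> (nat \<Rightarrow> 's) \<Rightarrow> ('s \<Rightarrow> real) \<Rightarrow> ('s \<Rightarrow> real) \<Rightarrow> real" where
  "sample_product n x u v \<equiv> \<Sum>i<n. u (x i) * v (x i)"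

interpretation sample: semi_inner_product UNIV "sample_product n x" for n x
  by standard
    (auto simp: algebra_simps sum_subtractf sum_distrib_left sum_nonneg intro!: sum.cong)

text \<open>
  The constant is put behind the controls, at index \<open>m\<close>: the first \<open>m\<close> regressors then serve to compute
  the residual of the constant, and all \<open>m + 1\<close> of them to solve the least squares problem.
\<close>

definition regressors :: "nat \<Rightarrow> (nat \<Rightarrow> 's \<Rightarrow> real) \<Rightarrow> nat \<Rightarrow> 's \<Rightarrow> real" where
  "regressors m h j = (if j < m then h j else (\<lambda>_. 1))"

definition intercept_residual ::
  "nat \<Rightarrow> nat \<Rightarrow> (nat \<Rightarrow> 's \<Rightarrow> real) \<Rightarrow> (nat \<Rightarrow> 's) \<Rightarrow> 's \<Rightarrow> real" where
  "intercept_residual n m h x = residual (sample_product n x) (regressors m h) m (\<lambda>_. 1)"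

lemma normal_equations_solvable: "\<exists>\<alpha> b. normal_equations n m h f x \<alpha> b"
proof -
  define e where "e = residual (sample_product n x) (regressors m h) (Suc m) f"
  obtain c where c: "e = (\<lambda>y. f y - (\<Sum>j<Suc m. c j * regressors m h j y))"
    unfolding e_def using residual_eq_minus_combination by blast
  have e: "e y = f y - c m - vec m c \<bullet> control_vec m h y" for y
    by (simp add: c regressors_def scalar_prod_control_vec)
  have orth: "sample_product n x e (regressors m h j) = 0" if "j < Suc m" for j
    unfolding e_def by (rule sample.residual_orthogonal) (use that in auto)
  have "normal_equations n m h f x (c m) (vec m c)"
    unfolding normal_equations_def e[symmetric]
  proof (intro conjI allI impI)
    show "(\<Sum>i<n. e (x i)) = 0" using orth[of m] by (simp add: regressors_def)
    show "sample_product n x e (h j) = 0" if "j < m" for j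
      using orth[of j] that by (simp add: regressors_def)
  qed simp
  then show ?thesis by blast
qed

lemma intercept_residual_eq:
  obtains c where "intercept_residual n m h x = (\<lambda>y. 1 - (\<Sum>j<m. c j * h j y))"
  using residual_eq_minus_combination[of "sample_product n x" "regressors m h" m "\<lambda>_. 1"]
  unfolding intercept_residual_def regressors_def by auto

lemma intercept_residual_orthogonal:
  "j < m \<Longrightarrow> sample_product n x (intercept_residual n m h x) (h j) = 0"
  using sample.residual_orthogonal[where u = "\<lambda>_. 1" and m = m and z = "regressors m h" and j = j
      and n = n and x = x]
  by (simp add: intercept_residual_def regressors_def)

text \<open>
  Pairing with the residual of the constant annihilates the controls and so reads off the intercept of a
  fitted function.
\<close>

lemma intercept_residual_combination:
  "(\<Sum>i<n. intercept_residual n m h x (x i) * (p + (\<Sum>j<m. c j * h j (x i))))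
     = p * (\<Sum>i<n. (intercept_residual n m h x (x i))\<^sup>2)"
proof -
  define r where "r = intercept_residual n m h x"
  have lin: "(\<Sum>i<n. r (x i) * (q + (\<Sum>j<m. c j * h j (x i)))) = q * (\<Sum>i<n. r (x i))" for q c
  proof -
    have "(\<Sum>i<n. r (x i) * (q + (\<Sum>j<m. c j * h j (x i))))
        = q * (\<Sum>i<n. r (x i)) + (\<Sum>i<n. \<Sum>j<m. c j * (r (x i) * h j (x i)))"
      by (simp add: sum_distrib_left distrib_left sum.distrib mult_ac)
    also have "(\<Sum>i<n. \<Sum>j<m. c j * (r (x i) * h j (x i)))
        = (\<Sum>j<m. c j * sample_product n x r (h j))"
      by (subst sum.swap) (simp add: sum_distrib_left)
    also have "\<dots> = 0" by (intro sum.neutral) (simp add: r_def intercept_residual_orthogonal)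
    finally show ?thesis by simp
  qed
  obtain c' where c': "r = (\<lambda>y. 1 - (\<Sum>j<m. c' j * h j y))"
    unfolding r_def by (rule intercept_residual_eq)
  have "(\<Sum>i<n. (r (x i))\<^sup>2) = (\<Sum>i<n. r (x i) * (1 + (\<Sum>j<m. - c' j * h j (x i))))"
    by (simp add: c' power2_eq_square sum_negf)
  also have "\<dots> = (\<Sum>i<n. r (x i))" using lin[of 1 "\<lambda>j. - c' j"] by simp
  finally show ?thesis using lin[of p c] by (simp add: r_def)
qed

text \<open>
  A minimizer always exists, and two minimizers have the same fitted values on the sample; pairing their
  difference with \<open>r\<close> shows that the intercepts agree unless \<open>r\<close> vanishes on the sample. If it does vanish,
  the constant is a combination of the controls there and can be shifted between \<open>\<alpha>\<close> and \<open>b\<close>. In that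
  case the quotient is \<open>0 / 0 = 0\<close>, the value that \<^const>\<open>olsmc\<close> takes by definition.
\<close>

lemma ols_closed_form:
  fixes n m h f x
  defines "r \<equiv> intercept_residual n m h x"
  shows olsmc_well_defined_iff:
      "olsmc_well_defined n m h f x \<longleftrightarrow> (\<Sum>i<n. (r (x i))\<^sup>2) \<noteq> 0"
    and olsmc_eq_quotient: "olsmc n m h f x = (\<Sum>i<n. r (x i) * f (x i)) / (\<Sum>i<n. (r (x i))\<^sup>2)"
    and olsmc_normal_equations:
      "olsmc_well_defined n m h f x \<Longrightarrow> \<exists>b. normal_equations n m h f x (olsmc n m h f x) b"
proof -
  obtain \<alpha> b where ab: "normal_equations n m h f x \<alpha> b"
    using normal_equations_solvable by blast
  note min = ols_minimizer_if_normal_equations[OF ab]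
  obtain c where c: "r = (\<lambda>y. 1 - (\<Sum>j<m. c j * h j y))"
    unfolding r_def by (rule intercept_residual_eq)
  have unique: "\<alpha>' = \<alpha>" if nz: "(\<Sum>i<n. (r (x i))\<^sup>2) \<noteq> 0" and "ols_minimizer n m h f x \<alpha>' b'" for \<alpha>' b'
  proof -
    define d where "d i = \<alpha> - \<alpha>' + (\<Sum>j<m. (b $ j - b' $ j) * h j (x i))" for i
    have "ols_loss n m h f x \<alpha>' b' \<le> ols_loss n m h f x \<alpha> b"
      using that(2) ab by (auto simp: ols_minimizer_def normal_equations_def)
    then have "(\<Sum>i<n. (d i)\<^sup>2) \<le> 0"
      unfolding ols_loss_normal_equations[OF ab, of \<alpha>' b'] d_def by simp
    then have "(\<Sum>i<n. (d i)\<^sup>2) = 0" by (simp add: antisym sum_nonneg)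
    then have "\<And>i. i < n \<Longrightarrow> d i = 0" by (simp add: sum_nonneg_eq_0_iff)
    then have "(\<Sum>i<n. r (x i) * d i) = 0" by simp
    moreover have "(\<Sum>i<n. r (x i) * d i) = (\<alpha> - \<alpha>') * (\<Sum>i<n. (r (x i))\<^sup>2)"
      unfolding d_def r_def by (rule intercept_residual_combination)
    ultimately show ?thesis using nz by auto
  qed
  have degenerate: "\<not> olsmc_well_defined n m h f x" if "(\<Sum>i<n. (r (x i))\<^sup>2) = 0"
  proof -
    have r0: "r (x i) = 0" if "i < n" for i
      using that \<open>(\<Sum>i<n. (r (x i))\<^sup>2) = 0\<close> by (simp add: sum_nonneg_eq_0_iff)
    define b' where "b' = vec m (\<lambda>j. b $ j - c j)"
    \<comment> \<open>Moving the intercept up by 1 is undone on the sample by the combination \<open>c\<close> of controls.\<close>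
    have "ols_loss n m h f x (\<alpha> + 1) b' = ols_loss n m h f x \<alpha> b"
      unfolding ols_loss_def
    proof (intro sum.cong refl)
      fix i assume "i \<in> {..<n}"
      then have "(\<Sum>j<m. c j * h j (x i)) = 1" using r0[of i] by (simp add: c)
      then show "(f (x i) - (\<alpha> + 1) - b' \<bullet> control_vec m h (x i))\<^sup>2
          = (f (x i) - \<alpha> - b \<bullet> control_vec m h (x i))\<^sup>2"
        by (simp add: scalar_prod_control_vec b'_def left_diff_distrib sum_subtractf diff_diff_eq)
    qed
    then have "ols_minimizer n m h f x (\<alpha> + 1) b'"
      using min by (auto simp: ols_minimizer_def b'_def)
    with min show ?thesis unfolding olsmc_well_defined_def by (metis add_cancel_right_right one_neq_zero)
  qed
  show wd: "olsmc_well_defined n m h f x \<longleftrightarrow> (\<Sum>i<n. (r (x i))\<^sup>2) \<noteq> 0"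
    using degenerate unique min unfolding olsmc_well_defined_def by metis
  have ols: "olsmc n m h f x = \<alpha>" if "(\<Sum>i<n. (r (x i))\<^sup>2) \<noteq> 0"
    using that unfolding olsmc_def if_P[OF wd[THEN iffD2, OF that]]
    by (intro the_equality) (use min unique in blast)+
  show "\<exists>b. normal_equations n m h f x (olsmc n m h f x) b" if "olsmc_well_defined n m h f x"
    using ols wd that ab by auto
  show "olsmc n m h f x = (\<Sum>i<n. r (x i) * f (x i)) / (\<Sum>i<n. (r (x i))\<^sup>2)"
  proof (cases "(\<Sum>i<n. (r (x i))\<^sup>2) = 0")
    case True
    then show ?thesis using wd by (simp add: olsmc_def)
  next
    case False
    define e where "e i = f (x i) - \<alpha> - b \<bullet> control_vec m h (x i)" for i
    have e_orth: "(\<Sum>i<n. e i) = 0" "\<And>j. j < m \<Longrightarrow> (\<Sum>i<n. e i * h j (x i)) = 0"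
      using ab by (auto simp: normal_equations_def e_def)
    have "(\<Sum>i<n. r (x i) * e i)
        = (\<Sum>i<n. e i) - (\<Sum>i<n. \<Sum>j<m. c j * (e i * h j (x i)))"
      by (simp add: c sum_distrib_left left_diff_distrib right_diff_distrib sum_subtractf
          sum_distrib_right mult_ac)
    also have "(\<Sum>i<n. \<Sum>j<m. c j * (e i * h j (x i))) = (\<Sum>j<m. c j * (\<Sum>i<n. e i * h j (x i)))"
      by (subst sum.swap) (simp add: sum_distrib_left)
    also have "\<dots> = 0" by (intro sum.neutral) (simp add: e_orth)
    finally have "(\<Sum>i<n. r (x i) * e i) = 0" by (simp add: e_orth)
    moreover have "(\<Sum>i<n. r (x i) * f (x i))
        = (\<Sum>i<n. r (x i) * e i) + (\<Sum>i<n. r (x i) * (\<alpha> + (\<Sum>j<m. b $ j * h j (x i))))"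
      by (simp add: e_def scalar_prod_control_vec algebra_simps flip: sum.distrib)
    moreover have "\<dots> = 0 + \<alpha> * (\<Sum>i<n. (r (x i))\<^sup>2)"
      using calculation(1) intercept_residual_combination[of n m h x \<alpha> "\<lambda>j. b $ j"]
      by (simp add: r_def)
    ultimately show ?thesis using ols[OF False] False by simp
  qed
qed

section \<open>Normal equations with a Gram matrix close to the identity\<close>

text \<open>
  Here \<open>A\<close>, \<open>a\<close>, \<open>v\<close>, \<open>w\<close> stand for the sample means of \<open>k k'\<close>, \<open>k\<close>, \<open>k \<epsilon>\<close>, \<open>\<epsilon>\<close>, while \<open>d\<close> and \<open>g\<close> are
  the errors in the intercept and in the coefficients. The Gram hypothesis gives
  \<open>g' A g \<ge> \<bar>g\<bar>\<^sup>2 / 2\<close>, so pairing the second equation with \<open>g\<close> yields \<open>\<bar>g\<bar> \<le> 2 (\<bar>v\<bar> + \<bar>d\<bar> \<bar>a\<bar>)\<close>; the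
  first equation says \<open>\<bar>d - w\<bar> \<le> \<bar>g\<bar> \<bar>a\<bar>\<close>, and \<open>\<bar>a\<bar> \<le> 1/2\<close> lets the term in \<open>\<bar>d\<bar>\<close> be absorbed.
\<close>

lemma normal_equations_perturbation:
  fixes A :: "'j \<Rightarrow> 'j \<Rightarrow> real"
  assumes J: "finite J"
    and gram: "(\<Sum>i\<in>J. \<Sum>j\<in>J. (A i j - (if i = j then 1 else 0))\<^sup>2) \<le> 1/4"
    and mean: "(\<Sum>j\<in>J. (a j)\<^sup>2) \<le> 1/4"
    and eq0: "w - d - (\<Sum>j\<in>J. g j * a j) = 0"
    and eq: "\<And>j. j \<in> J \<Longrightarrow> v j - d * a j - (\<Sum>i\<in>J. g i * A i j) = 0"
  shows "\<bar>d - w\<bar> \<le> 4 * L2_set a J * L2_set v J + 2 * L2_set a J * \<bar>w\<bar>"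
proof -
  define \<gamma> p \<nu> where "\<gamma> = L2_set g J" "p = L2_set a J" "\<nu> = L2_set v J"
  note defs = \<gamma>_p_\<nu>_def
  have nn: "0 \<le> \<gamma>" "0 \<le> p" "0 \<le> \<nu>" by (simp_all add: defs)
  have CS: "\<bar>\<Sum>j\<in>J. s j * t j\<bar> \<le> L2_set s J * L2_set t J" for s t :: "'j \<Rightarrow> real"
    using L2_set_mult_ineq[of s t J] sum_abs[of "\<lambda>j. s j * t j" J] by (simp add: abs_mult)
  have sq: "\<gamma>\<^sup>2 = (\<Sum>j\<in>J. (g j)\<^sup>2)" by (simp add: defs L2_set_def sum_nonneg)
  have p: "p \<le> 1/2"
    using real_sqrt_le_mono[OF mean] by (simp add: defs L2_set_def real_sqrt_divide)
  define E where "E ij = A (fst ij) (snd ij) - (if fst ij = snd ij then 1 else 0)" for ij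
  have E: "L2_set E (J \<times> J) \<le> 1/2"
    using real_sqrt_le_mono[OF gram]
    by (simp add: L2_set_def E_def real_sqrt_divide sum.cartesian_product case_prod_beta)
  have gg: "L2_set (\<lambda>ij. g (fst ij) * g (snd ij)) (J \<times> J) = \<gamma>\<^sup>2"
  proof -
    have "(\<Sum>ij\<in>J \<times> J. (g (fst ij) * g (snd ij))\<^sup>2) = (\<Sum>i\<in>J. (g i)\<^sup>2) * (\<Sum>j\<in>J. (g j)\<^sup>2)"
      by (simp add: power_mult_distrib sum_product sum.cartesian_product case_prod_beta)
    also have "\<dots> = (\<gamma>\<^sup>2)\<^sup>2" by (simp only: sq[symmetric]) (simp only: power2_eq_square)
    finally show ?thesis by (simp only: L2_set_def real_sqrt_abs) simp
  qed
  have "\<bar>\<Sum>ij\<in>J \<times> J. g (fst ij) * g (snd ij) * E ij\<bar> \<le> \<gamma>\<^sup>2 * L2_set E (J \<times> J)"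
    using L2_set_mult_ineq[of "\<lambda>ij. g (fst ij) * g (snd ij)" E "J \<times> J"]
      sum_abs[of "\<lambda>ij. g (fst ij) * g (snd ij) * E ij" "J \<times> J"] gg by (simp add: abs_mult)
  also have "\<dots> \<le> \<gamma>\<^sup>2 / 2" using mult_left_mono[OF E, of "\<gamma>\<^sup>2"] by simp
  finally have pert: "\<bar>\<Sum>ij\<in>J \<times> J. g (fst ij) * g (snd ij) * E ij\<bar> \<le> \<gamma>\<^sup>2 / 2" .
  have "(\<Sum>j\<in>J. g j * (\<Sum>i\<in>J. g i * A i j)) = (\<Sum>i\<in>J. \<Sum>j\<in>J. g i * g j * A i j)"
    by (subst sum.swap) (simp add: sum_distrib_left mult_ac)
  also have "\<dots> = (\<Sum>i\<in>J. \<Sum>j\<in>J. g i * g j * E (i, j) + (if i = j then g i * g j else 0))"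
    by (intro sum.cong refl) (simp add: E_def algebra_simps)
  also have "\<dots> = (\<Sum>ij\<in>J \<times> J. g (fst ij) * g (snd ij) * E ij) + \<gamma>\<^sup>2"
    using J by (simp add: sum.distrib sum.cartesian_product case_prod_beta power2_eq_square
        sq[unfolded power2_eq_square])
  finally have coercive: "\<gamma>\<^sup>2 / 2 \<le> (\<Sum>j\<in>J. g j * (\<Sum>i\<in>J. g i * A i j))"
    using pert by linarith
  have "(\<Sum>j\<in>J. g j * (\<Sum>i\<in>J. g i * A i j)) = (\<Sum>j\<in>J. g j * (v j - d * a j))"
    using eq by (intro sum.cong refl) (simp add: algebra_simps)
  also have "\<dots> = (\<Sum>j\<in>J. g j * v j) - d * (\<Sum>j\<in>J. g j * a j)"
    by (simp add: algebra_simps sum_subtractf sum_distrib_left)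
  also have "\<dots> \<le> \<gamma> * \<nu> + \<bar>d\<bar> * (\<gamma> * p)"
  proof -
    have "\<bar>d * (\<Sum>j\<in>J. g j * a j)\<bar> \<le> \<bar>d\<bar> * (\<gamma> * p)"
      unfolding abs_mult using CS[of g a] by (intro mult_left_mono) (auto simp: defs)
    then show ?thesis using CS[of g v] by (simp add: defs)
  qed
  finally have "\<gamma>\<^sup>2 / 2 \<le> \<gamma> * (\<nu> + \<bar>d\<bar> * p)" using coercive by (simp add: algebra_simps)
  then have \<gamma>: "\<gamma> \<le> 2 * (\<nu> + \<bar>d\<bar> * p)"
    using nn by (cases "\<gamma> = 0") (auto simp: power2_eq_square)
  have dw: "\<bar>d - w\<bar> \<le> \<gamma> * p"
    using CS[of g a] eq0 by (simp add: defs)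
  also have "\<dots> \<le> 2 * (\<nu> + \<bar>d\<bar> * p) * p" using \<gamma> nn by (intro mult_right_mono)
  finally have dw: "\<bar>d - w\<bar> \<le> 2 * p * \<nu> + 2 * p\<^sup>2 * \<bar>d\<bar>"
    by (simp add: algebra_simps power2_eq_square)
  have p2: "2 * p\<^sup>2 \<le> p" using mult_right_mono[OF p nn(2)] by (simp add: power2_eq_square)
  have "2 * p\<^sup>2 * \<bar>d\<bar> \<le> \<bar>d\<bar> / 2" using p p2 mult_right_mono[of "2 * p\<^sup>2" "1/2" "\<bar>d\<bar>"] by simp
  then have d: "\<bar>d\<bar> \<le> 2 * \<bar>w\<bar> + 4 * p * \<nu>" using dw by linarith
  have "2 * p\<^sup>2 * \<bar>d\<bar> \<le> p * (2 * \<bar>w\<bar> + 4 * p * \<nu>)"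
    using p2 d nn by (intro mult_mono) auto
  also have "\<dots> = 2 * p * \<bar>w\<bar> + 2 * (2 * p\<^sup>2) * \<nu>" by (simp add: algebra_simps power2_eq_square)
  also have "2 * (2 * p\<^sup>2) * \<nu> \<le> 2 * p * \<nu>"
    using p2 nn by (intro mult_right_mono) auto
  finally show ?thesis using dw by (simp add: defs)
qed

section \<open>Square integrable controls\<close>

lemma L2_mult_integrable:
  assumes "u \<in> L2 P" "v \<in> L2 P"
  shows "integrable P (\<lambda>x. u x * v x)"
proof (rule Bochner_Integration.integrable_bound)
  show "integrable P (\<lambda>x. (u x)\<^sup>2 + (v x)\<^sup>2)"
    using assms by (intro Bochner_Integration.integrable_add) (auto simp: L2_def)
  show "(\<lambda>x. u x * v x) \<in> borel_measurable P"
    using assms by (auto simp: L2_def)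
  show "AE x in P. norm (u x * v x) \<le> norm ((u x)\<^sup>2 + (v x)\<^sup>2)"
  proof (intro AE_I2)
    fix x
    have "2 * \<bar>u x * v x\<bar> \<le> (u x)\<^sup>2 + (v x)\<^sup>2"
      using sum_squares_bound[of "\<bar>u x\<bar>" "\<bar>v x\<bar>"] by (simp add: abs_mult mult.assoc)
    then show "norm (u x * v x) \<le> norm ((u x)\<^sup>2 + (v x)\<^sup>2)" by simp
  qed
qed

lemma L2_minus_scaled:
  assumes "u \<in> L2 P" "v \<in> L2 P"
  shows "(\<lambda>x. u x - c * v x) \<in> L2 P"
proof -
  have "integrable P (\<lambda>x. (u x)\<^sup>2 + c\<^sup>2 * (v x)\<^sup>2 - 2 * c * (u x * v x))"
    using assms L2_mult_integrable[OF assms] by (auto simp: L2_def)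
  also have "(\<lambda>x. (u x)\<^sup>2 + c\<^sup>2 * (v x)\<^sup>2 - 2 * c * (u x * v x)) = (\<lambda>x. (u x - c * v x)\<^sup>2)"
    by (simp add: power2_eq_square algebra_simps)
  finally show ?thesis using assms by (auto simp: L2_def)
qed

abbreviation L2_product :: "'s measure \<Rightarrow> ('s \<Rightarrow> real) \<Rightarrow> ('s \<Rightarrow> real) \<Rightarrow> real" where
  "L2_product P u v \<equiv> \<integral>x. u x * v x \<partial>P"

interpretation L2: semi_inner_product "L2 P" "L2_product P" for P
proof
  fix u v w :: "'a \<Rightarrow> real" and c :: real
  assume "u \<in> L2 P" "v \<in> L2 P" "w \<in> L2 P"
  then show "L2_product P (\<lambda>x. u x - c * v x) w = L2_product P u w - c * L2_product P v w"
    using L2_mult_integrable[of u P w] L2_mult_integrable[of v P w]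
    by (simp add: left_diff_distrib mult.assoc)
qed (auto simp: L2_minus_scaled mult.commute)

lemma (in prob_space) const_in_L2: "(\<lambda>_. c) \<in> L2 M"
  by (simp add: L2_def)

lemma (in prob_space) L2_integrable:
  assumes "u \<in> L2 M"
  shows "integrable M u"
  using L2_mult_integrable[OF assms const_in_L2[of 1]] by simp

lemma L2_null_AE:
  assumes "u \<in> L2 P" "L2_product P u u = 0"
  shows "AE x in P. u x = 0"
  using assms integral_nonneg_eq_0_iff_AE[of P "\<lambda>x. u x * u x"] L2_mult_integrable[of u P u]
  by simp

lemma L2_combination:
  fixes m :: nat
  assumes "\<And>j. j < m \<Longrightarrow> h j \<in> L2 P" "w \<in> L2 P"
  shows "(\<lambda>x. \<Sum>j<m. c j * h j x) \<in> L2 P"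
    and "L2_product P (\<lambda>x. \<Sum>j<m. c j * h j x) w = (\<Sum>j<m. c j * L2_product P (h j) w)"
proof -
  have zero: "(\<lambda>_. 0) \<in> L2 P" by (simp add: L2_def)
  show "(\<lambda>x. \<Sum>j<m. c j * h j x) \<in> L2 P"
    using L2.combination(1)[OF zero assms(2), of m h "\<lambda>j. - c j"] assms(1)
    by (simp add: sum_negf)
  show "L2_product P (\<lambda>x. \<Sum>j<m. c j * h j x) w = (\<Sum>j<m. c j * L2_product P (h j) w)"
    using L2.combination(2)[OF zero assms(2), of m h "\<lambda>j. - c j"] assms(1)
    by (simp add: sum_negf)
qed

text \<open>
  With \<open>T\<close> the matrix taking \<open>h\<close> to \<open>k\<close> and \<open>G\<close> the Gram matrix of \<open>h\<close>, orthonormality is \<open>T G T' = 1\<close>.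
  Since one-sided inverses of square matrices are two-sided, \<open>T' T\<close> is the inverse of \<open>G\<close>, so that
  \<open>q = h' T' T h = k' k\<close>, and \<open>G T'\<close> is the inverse of \<open>T\<close>. The latter recovers the \<open>h\<^sub>l\<close> from the \<open>k\<^sub>j\<close>
  at every point, not only almost everywhere, which is what evaluation on a sample requires.
\<close>

lemma leverage_orthonormal:
  fixes T :: "nat \<Rightarrow> nat \<Rightarrow> real" and m :: nat
  assumes h: "\<And>j. j < m \<Longrightarrow> h j \<in> L2 P"
    and k: "\<And>j. j < m \<Longrightarrow> k j = (\<lambda>x. \<Sum>l<m. T j l * h l x)"
    and orthonormal: "\<And>i j. i < m \<Longrightarrow> j < m \<Longrightarrow> L2_product P (k i) (k j) = (if i = j then 1 else 0)"
  shows "leverage P m h x = (\<Sum>j<m. (k j x)\<^sup>2)"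
    and "\<exists>S. \<forall>l<m. \<forall>x. h l x = (\<Sum>j<m. S l j * k j x)"
proof -
  define A where "A = mat m m (\<lambda>(j, l). T j l)"
  define G where "G = gram P m h"
  have A: "A \<in> carrier_mat m m" and G: "G \<in> carrier_mat m m"
    by (auto simp: A_def G_def gram_def)
  have At: "transpose_mat A \<in> carrier_mat m m" using A by simp
  have kL2: "k j \<in> L2 P" if "j < m" for j
    unfolding k[OF that] by (rule L2_combination(1)[OF h]) (use h that in auto)
  have GA: "(\<Sum>b<m. G $$ (a, b) * T j b) = L2_product P (h a) (k j)" if "a < m" "j < m" for a j
  proof -
    have "L2_product P (k j) (h a) = (\<Sum>b<m. T j b * L2_product P (h b) (h a))"
      unfolding k[OF that(2)] by (rule L2_combination(2)) (use h that in auto)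
    then show ?thesis
      using that by (simp add: G_def gram_def mult.commute)
  qed
  have id: "A * (G * transpose_mat A) = 1\<^sub>m m"
  proof (rule eq_matI)
    fix i j assume ij: "i < dim_row (1\<^sub>m m :: real mat)" "j < dim_col (1\<^sub>m m :: real mat)"
    then have "(A * (G * transpose_mat A)) $$ (i, j)
        = (\<Sum>a<m. T i a * (\<Sum>b<m. G $$ (a, b) * T j b))"
      using A G by (simp add: scalar_prod_def A_def lessThan_atLeast0)
    also have "\<dots> = (\<Sum>a<m. T i a * L2_product P (h a) (k j))"
      using ij by (intro sum.cong) (auto simp: GA)
    also have "\<dots> = L2_product P (k i) (k j)"
      using ij by (simp add: k[of i] L2_combination(2)[OF h kL2])
    finally show "(A * (G * transpose_mat A)) $$ (i, j) = 1\<^sub>m m $$ (i, j)"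
      using ij by (simp add: orthonormal)
  qed (use A in auto)
  have inv: "(G * transpose_mat A) * A = 1\<^sub>m m"
    by (rule mat_mult_left_right_inverse[OF A _ id]) (use A G in auto)
  have AtA: "transpose_mat A * A \<in> carrier_mat m m" using A by auto
  have right: "G * (transpose_mat A * A) = 1\<^sub>m m"
    using inv assoc_mult_mat[OF G At A] by simp
  then have left: "(transpose_mat A * A) * G = 1\<^sub>m m"
    by (rule mat_mult_left_right_inverse[OF G AtA])
  have the_inv: "the (mat_inverse G) = transpose_mat A * A"
  proof (cases "mat_inverse G")
    case None
    then show ?thesis
      using mat_inverse(1)[OF G, of "()"] left right G AtA by (auto simp: Units_def ring_mat_def)
  next
    case (Some C)
    then have C: "C * G = 1\<^sub>m m" "C \<in> carrier_mat m m" using mat_inverse(2)[OF G Some] by auto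
    have "C = C * (G * (transpose_mat A * A))" using C right by simp
    also have "\<dots> = (C * G) * (transpose_mat A * A)"
      using assoc_mult_mat[OF C(2) G AtA] by (simp only:)
    also have "\<dots> = transpose_mat A * A" using C(1) left_mult_one_mat[OF AtA] by simp
    finally show ?thesis using Some by simp
  qed
  have cv: "control_vec m h y \<in> carrier_vec m" for y by (simp add: control_vec_def)
  have kv: "A *\<^sub>v control_vec m h y = vec m (\<lambda>j. k j y)" for y
    by (rule eq_vecI) (auto simp: A_def control_vec_def scalar_prod_def k lessThan_atLeast0)
  have "leverage P m h x
      = control_vec m h x \<bullet> (transpose_mat A *\<^sub>v (A *\<^sub>v control_vec m h x))"
    using the_inv A At cv unfolding leverage_def G_def by (simp add: assoc_mult_mat_vec)
  also have "\<dots> = (transpose_mat A *\<^sub>v (A *\<^sub>v control_vec m h x)) \<bullet> control_vec m h x"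
    using A cv by (intro comm_scalar_prod) auto
  also have "\<dots> = (A *\<^sub>v control_vec m h x) \<bullet> (A *\<^sub>v control_vec m h x)"
    using A cv by (intro transpose_vec_mult_scalar) auto
  also have "\<dots> = (\<Sum>j<m. (k j x)\<^sup>2)"
    by (simp add: kv scalar_prod_def power2_eq_square lessThan_atLeast0)
  finally show "leverage P m h x = (\<Sum>j<m. (k j x)\<^sup>2)" .
  define B where "B = G * transpose_mat A"
  have B: "B \<in> carrier_mat m m" and BA: "B * A = 1\<^sub>m m"
    using A G inv by (auto simp: B_def)
  have "h l y = (\<Sum>j<m. B $$ (l, j) * k j y)" if "l < m" for l y
  proof -
    have "control_vec m h y = (B * A) *\<^sub>v control_vec m h y"
      using BA cv[of y] by simp
    also have "\<dots> = B *\<^sub>v vec m (\<lambda>j. k j y)"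
      unfolding kv[symmetric] using A B cv by (intro assoc_mult_mat_vec) auto
    finally have "control_vec m h y $ l = (B *\<^sub>v vec m (\<lambda>j. k j y)) $ l"
      by simp
    then show ?thesis
      using that B by (simp add: control_vec_def scalar_prod_def lessThan_atLeast0)
  qed
  then show "\<exists>S. \<forall>l<m. \<forall>x. h l x = (\<Sum>j<m. S l j * k j x)"
    by (intro exI[of _ "\<lambda>l j. B $$ (l, j)"]) auto
qed

text \<open>
  Gram-Schmidt: linear independence is used for the norms of the residuals of \<open>h j\<close> on \<open>h 0\<close> to \<open>h (j - 1)\<close>
  to be positive.
\<close>

lemma orthonormal_controls:
  fixes m :: nat
  assumes h: "\<And>j. j < m \<Longrightarrow> h j \<in> L2 P" and indep: "lin_indep_L2 P m h"
  obtains k T where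
    "\<And>j. j < m \<Longrightarrow> k j = (\<lambda>x. \<Sum>l<m. T j l * h l x)"
    "\<And>i j. i < m \<Longrightarrow> j < m \<Longrightarrow> L2_product P (k i) (k j) = (if i = j then 1 else 0)"
proof -
  define r where "r j = residual (L2_product P) h j (h j)" for j
  have "\<forall>j. \<exists>c. r j = (\<lambda>x. h j x - (\<Sum>l<j. c l * h l x))"
    unfolding r_def by (intro allI residual_eq_minus_combination)
  then obtain c where c: "\<And>j. r j = (\<lambda>x. h j x - (\<Sum>l<j. c j l * h l x))" by metis
  have rL2: "r j \<in> L2 P" if "j < m" for j
    unfolding r_def by (rule L2.residual_closed) (use h that in auto)
  have orth: "L2_product P (r j) (h l) = 0" if "l < j" "j < m" for l j
    unfolding r_def by (rule L2.residual_orthogonal) (use h that in auto)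
  have rorth: "L2_product P (r i) (r j) = 0" if "i < j" "j < m" for i j
  proof -
    have "L2_product P (r i) (r j) = L2_product P (h i) (r j) - (\<Sum>l<i. c i l * L2_product P (h l) (r j))"
      unfolding c[of i] by (rule L2.combination(2)) (use h that rL2 in auto)
    also have "\<dots> = 0"
      using that orth L2.commute[OF h rL2, of _ j] by simp
    finally show ?thesis .
  qed
  define s where "s j = L2_product P (r j) (r j)" for j
  have r_eq: "r j = (\<lambda>x. \<Sum>l<m. (if l = j then 1 else if l < j then - c j l else 0) * h l x)"
    if "j < m" for j
  proof
    fix x
    have "(\<Sum>l<m. (if l = j then 1 else if l < j then - c j l else 0) * h l x)
        = (\<Sum>l<m. (if l = j then h l x else 0) - (if l \<in> {..<j} then c j l * h l x else 0))"
      by (intro sum.cong) auto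
    also have "\<dots> = (\<Sum>l<m. if l = j then h l x else 0) - (\<Sum>l\<in>{..<m} \<inter> {..<j}. c j l * h l x)"
      by (simp add: sum_subtractf sum.inter_restrict)
    also have "{..<m} \<inter> {..<j} = {..<j}" using that by auto
    finally show "r j x = (\<Sum>l<m. (if l = j then 1 else if l < j then - c j l else 0) * h l x)"
      using that by (simp add: c)
  qed
  have s: "s j > 0" if "j < m" for j
  proof (rule ccontr)
    assume "\<not> s j > 0"
    then have "L2_product P (r j) (r j) = 0"
      using L2.nonneg[OF rL2[OF that]] by (simp add: s_def)
    then have "AE x in P. r j x = 0"
      using L2_null_AE[OF rL2[OF that]] by simp
    then have "AE x in P. (\<Sum>l<m. (if l = j then 1 else if l < j then - c j l else 0) * h l x) = 0"
      unfolding r_eq[OF that] .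
    from indep[unfolded lin_indep_L2_def, rule_format, OF this that] show False by simp
  qed
  define k where "k j = (\<lambda>x. r j x / sqrt (s j))" for j
  show thesis
  proof
    fix j assume "j < m"
    then show "k j = (\<lambda>x. \<Sum>l<m. (if l = j then 1 else if l < j then - c j l else 0) / sqrt (s j) * h l x)"
      unfolding k_def by (subst r_eq) (auto simp: sum_divide_distrib)
  next
    fix i j assume ij: "i < m" "j < m"
    have "L2_product P (k i) (k j) = L2_product P (r i) (r j) / (sqrt (s i) * sqrt (s j))"
      by (simp add: k_def)
    also have "\<dots> = (if i = j then 1 else 0)"
    proof (cases "i = j")
      case True
      then show ?thesis using s[OF ij(1)] by (simp flip: s_def)
    next
      case False
      then have "L2_product P (r i) (r j) = 0"
        using rorth[of i j] rorth[of j i] ij L2.commute[OF rL2 rL2, of i j] by linarith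
      then show ?thesis using False by simp
    qed
    finally show "L2_product P (k i) (k j) = (if i = j then 1 else 0)" .
  qed
qed

text \<open>
  The coefficients in \<^const>\<open>proj_coef\<close> are given by a definite description; existence comes from the
  Gram-Schmidt residual and uniqueness from linear independence, as the difference of two solutions is a
  combination of the controls orthogonal to all of them.
\<close>

lemma (in prob_space) resid_properties:
  assumes h: "\<And>j. j < m \<Longrightarrow> h j \<in> L2 M" and mean: "\<And>j. j < m \<Longrightarrow> integral\<^sup>L M (h j) = 0"
    and indep: "lin_indep_L2 M m h" and f: "f \<in> L2 M"
  shows "resid M m h f \<in> L2 M"
    and "integral\<^sup>L M (resid M m h f) = 0"
    and "\<And>j. j < m \<Longrightarrow> L2_product M (resid M m h f) (h j) = 0"
proof -
  define \<mu> where "\<mu> = integral\<^sup>L M f"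
  define e where "e b = (\<lambda>x. f x - \<mu> - (\<Sum>j<m. b $ j * h j x))" for b :: "real vec"
  define Q where "Q b \<longleftrightarrow> b \<in> carrier_vec m \<and> (\<forall>j<m. L2_product M (e b) (h j) = 0)" for b
  have coef: "proj_coef M m h f = (THE b. Q b)"
    unfolding proj_coef_def Q_def e_def \<mu>_def scalar_prod_control_vec ..
  have res: "resid M m h f = e (proj_coef M m h f)"
    unfolding resid_def[abs_def] e_def \<mu>_def scalar_prod_control_vec ..
  have fc: "(\<lambda>x. f x - \<mu>) \<in> L2 M"
    using L2_minus_scaled[OF f const_in_L2[of 1], of \<mu>] by simp
  have eL2: "e b \<in> L2 M" for b
    unfolding e_def by (rule L2.combination(1)[OF fc f h])
  obtain c where c: "residual (L2_product M) h m (\<lambda>x. f x - \<mu>) = (\<lambda>x. f x - \<mu> - (\<Sum>j<m. c j * h j x))"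
    using residual_eq_minus_combination by blast
  have "residual (L2_product M) h m (\<lambda>x. f x - \<mu>) = e (vec m c)"
    by (simp add: c e_def)
  then have "Q (vec m c)"
    using L2.residual_orthogonal[where z = h and m = m, OF fc h] by (auto simp: Q_def)
  moreover have "b' = b" if b: "Q b'" "Q b" for b b'
  proof -
    define d where "d = (\<lambda>x. \<Sum>j<m. (b $ j - b' $ j) * h j x)"
    have "d = (\<lambda>x. e b' x - 1 * e b x)"
      by (simp add: d_def e_def left_diff_distrib sum_subtractf)
    then have orth: "L2_product M d (h j) = 0" if "j < m" for j
      using that b L2.minus_scaled[where c = 1, OF eL2[of b'] eL2[of b] h[OF that]] by (simp add: Q_def)
    have d: "d \<in> L2 M" unfolding d_def by (rule L2_combination(1)[OF h f])
    have "L2_product M d d = (\<Sum>j<m. (b $ j - b' $ j) * L2_product M (h j) d)"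
      by (subst (1) d_def) (rule L2_combination(2)[OF h d])
    also have "\<dots> = 0"
      using orth by (intro sum.neutral) (simp add: L2.commute[OF h d])
    finally have "AE x in M. d x = 0" by (rule L2_null_AE[OF d])
    then have "\<forall>j<m. b $ j - b' $ j = 0"
      using indep[unfolded lin_indep_L2_def, rule_format, of "\<lambda>j. b $ j - b' $ j"]
      unfolding d_def by simp
    then show "b' = b" using b by (intro eq_vecI) (auto simp: Q_def)
  qed
  ultimately have "\<exists>!b. Q b" by blast
  then have Q: "Q (proj_coef M m h f)"
    unfolding coef by (rule theI')
  show "resid M m h f \<in> L2 M" unfolding res by (rule eL2)
  show "\<And>j. j < m \<Longrightarrow> L2_product M (resid M m h f) (h j) = 0"
    using Q unfolding res Q_def by blast
  show "integral\<^sup>L M (resid M m h f) = 0"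
    using L2.combination(2)[where c = "\<lambda>j. proj_coef M m h f $ j" and z = h and m = m,
        OF fc const_in_L2[of 1] h]
      mean L2_integrable[OF f]
    by (simp add: res e_def \<mu>_def prob_space)
qed

section \<open>The estimator when the sample resembles the population\<close>

text \<open>
  The normal equations depend only on the span of the controls. They are rewritten for the error
  \<open>d\<close> of the intercept and for the basis \<open>k\<close>, in the form that \<open>normal_equations_perturbation\<close> takes.
\<close>

lemma normal_equations_in_coordinates:
  fixes n m :: nat and k h :: "nat \<Rightarrow> 's \<Rightarrow> real" and x :: "nat \<Rightarrow> 's"
  assumes n: "n > 0"
    and k: "\<And>j. j < m \<Longrightarrow> k j = (\<lambda>y. \<Sum>l<m. T j l * h l y)"
    and h: "\<And>l y. l < m \<Longrightarrow> h l y = (\<Sum>j<m. S l j * k j y)"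
    and e: "e = (\<lambda>y. \<epsilon> y - d - (\<Sum>l<m. c l * h l y))"
    and orth: "(\<Sum>i<n. e (x i)) = 0" "\<And>j. j < m \<Longrightarrow> (\<Sum>i<n. e (x i) * h j (x i)) = 0"
  obtains g where "emp_mean n x \<epsilon> - d - (\<Sum>j<m. g j * emp_mean n x (k j)) = 0"
    "\<And>j. j < m \<Longrightarrow> emp_mean n x (\<lambda>y. k j y * \<epsilon> y) - d * emp_mean n x (k j)
        - (\<Sum>i<m. g i * emp_mean n x (\<lambda>y. k i y * k j y)) = 0"
proof
  define g where "g j = (\<Sum>l<m. c l * S l j)" for j
  have "(\<Sum>l<m. c l * h l y) = (\<Sum>j<m. g j * k j y)" for y
  proof -
    have "(\<Sum>l<m. c l * h l y) = (\<Sum>l<m. \<Sum>j<m. c l * S l j * k j y)"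
      by (simp add: h sum_distrib_left mult.assoc)
    also have "\<dots> = (\<Sum>j<m. g j * k j y)"
      by (subst sum.swap) (simp add: g_def sum_distrib_right)
    finally show ?thesis .
  qed
  then have e': "e = (\<lambda>y. \<epsilon> y - d - (\<Sum>j<m. g j * k j y))" by (simp add: e)
  have sum: "(\<Sum>i<n. e (x i) * t (x i)) / real n
      = emp_mean n x (\<lambda>y. t y * \<epsilon> y) - d * emp_mean n x t
        - (\<Sum>i<m. g i * emp_mean n x (\<lambda>y. k i y * t y))" for t
  proof -
    have "(\<Sum>i<n. e (x i) * t (x i))
        = (\<Sum>i<n. t (x i) * \<epsilon> (x i)) - d * (\<Sum>i<n. t (x i))
          - (\<Sum>i<n. \<Sum>j<m. g j * (k j (x i) * t (x i)))"
      by (simp add: e' left_diff_distrib right_diff_distrib sum_subtractf sum_distrib_left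
          sum_distrib_right mult_ac)
    also have "(\<Sum>i<n. \<Sum>j<m. g j * (k j (x i) * t (x i)))
        = (\<Sum>j<m. g j * (\<Sum>i<n. k j (x i) * t (x i)))"
      by (subst sum.swap) (simp add: sum_distrib_left)
    finally show ?thesis
      by (simp add: emp_mean_def diff_divide_distrib sum_divide_distrib[where A = "{..<m}"])
  qed
  show "emp_mean n x \<epsilon> - d - (\<Sum>j<m. g j * emp_mean n x (k j)) = 0"
    using sum[of "\<lambda>_. 1"] orth(1) n by (simp add: emp_mean_def)
  fix j assume j: "j < m"
  have "(\<Sum>i<n. e (x i) * k j (x i)) = (\<Sum>i<n. \<Sum>l<m. T j l * (e (x i) * h l (x i)))"
    by (simp add: k[OF j] sum_distrib_left mult_ac)
  also have "\<dots> = (\<Sum>l<m. T j l * (\<Sum>i<n. e (x i) * h l (x i)))"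
    by (subst sum.swap) (simp add: sum_distrib_left)
  also have "\<dots> = 0" by (intro sum.neutral) (simp add: orth(2))
  finally show "emp_mean n x (\<lambda>y. k j y * \<epsilon> y) - d * emp_mean n x (k j)
        - (\<Sum>i<m. g i * emp_mean n x (\<lambda>y. k i y * k j y)) = 0"
    using sum[of "k j"] by simp
qed

text \<open>
  The perturbation bound is used twice. Applied to \<open>\<epsilon> = 0\<close> it shows that the constant is not a combination of
  the controls on the sample; applied to the least squares fit of \<open>f\<close> it bounds the error.
\<close>

lemma olsmc_linearization_error:
  fixes n m :: nat and k h :: "nat \<Rightarrow> 's \<Rightarrow> real" and x :: "nat \<Rightarrow> 's"
  assumes n: "n > 0"
    and k: "\<And>j. j < m \<Longrightarrow> k j = (\<lambda>y. \<Sum>l<m. T j l * h l y)"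
    and h: "\<And>l y. l < m \<Longrightarrow> h l y = (\<Sum>j<m. S l j * k j y)"
    and gram: "(\<Sum>i<m. \<Sum>j<m. (emp_mean n x (\<lambda>y. k i y * k j y) - (if i = j then 1 else 0))\<^sup>2) \<le> 1/4"
    and mean: "(\<Sum>j<m. (emp_mean n x (k j))\<^sup>2) \<le> 1/4"
    and f: "f = (\<lambda>y. \<mu> + (\<Sum>l<m. \<beta> l * h l y) + \<epsilon> y)"
  shows "olsmc_well_defined n m h f x"
    and "\<bar>olsmc n m h f x - \<mu> - emp_mean n x \<epsilon>\<bar>
      \<le> 4 * L2_set (\<lambda>j. emp_mean n x (k j)) {..<m} * L2_set (\<lambda>j. emp_mean n x (\<lambda>y. k j y * \<epsilon> y)) {..<m}
        + 2 * L2_set (\<lambda>j. emp_mean n x (k j)) {..<m} * \<bar>emp_mean n x \<epsilon>\<bar>"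
proof -
  show wd: "olsmc_well_defined n m h f x"
  proof (rule ccontr)
    assume "\<not> olsmc_well_defined n m h f x"
    then have r0: "\<And>i. i < n \<Longrightarrow> intercept_residual n m h x (x i) = 0"
      by (simp add: olsmc_well_defined_iff sum_nonneg_eq_0_iff)
    obtain c where c: "intercept_residual n m h x = (\<lambda>y. 1 - (\<Sum>j<m. c j * h j y))"
      by (rule intercept_residual_eq)
    \<comment> \<open>The intercept \<open>-1\<close> would then solve the normal equations of the zero integrand.\<close>
    obtain g where g: "emp_mean n x (\<lambda>_. 0) - (-1) - (\<Sum>j<m. g j * emp_mean n x (k j)) = 0"
      "\<And>j. j < m \<Longrightarrow> emp_mean n x (\<lambda>y. k j y * 0) - (-1) * emp_mean n x (k j)
        - (\<Sum>i<m. g i * emp_mean n x (\<lambda>y. k i y * k j y)) = 0"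
    proof (rule normal_equations_in_coordinates[OF n k h, where \<epsilon> = "\<lambda>_. 0" and d = "-1" and c = c
          and x = x])
      show "(\<Sum>i<n. (\<lambda>y. 0 - (-1) - (\<Sum>l<m. c l * h l y)) (x i)) = 0"
        "\<And>j. (\<Sum>i<n. (\<lambda>y. 0 - (-1) - (\<Sum>l<m. c l * h l y)) (x i) * h j (x i)) = 0"
        using r0 by (simp_all add: c)
    qed auto
    have zero: "emp_mean n x (\<lambda>_. 0) = 0" by (simp add: emp_mean_def)
    have "\<bar>(-1) - (0::real)\<bar> \<le> 4 * L2_set (\<lambda>j. emp_mean n x (k j)) {..<m} * L2_set (\<lambda>_. 0) {..<m}
        + 2 * L2_set (\<lambda>j. emp_mean n x (k j)) {..<m} * \<bar>0\<bar>"
      by (rule normal_equations_perturbation[OF _ gram mean g(1)[unfolded zero]]) (use g(2) zero in auto)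
    then show False by (simp add: L2_set_def)
  qed
  obtain b where b: "normal_equations n m h f x (olsmc n m h f x) b"
    using olsmc_normal_equations[OF wd] by blast
  define e where "e = (\<lambda>y. \<epsilon> y - (olsmc n m h f x - \<mu>) - (\<Sum>l<m. (b $ l - \<beta> l) * h l y))"
  have e: "e y = f y - olsmc n m h f x - b \<bullet> control_vec m h y" for y
  proof -
    have "(\<Sum>l<m. (b $ l - \<beta> l) * h l y) = b \<bullet> control_vec m h y - (\<Sum>l<m. \<beta> l * h l y)"
      by (simp add: scalar_prod_control_vec left_diff_distrib sum_subtractf)
    moreover have "f y = \<mu> + (\<Sum>l<m. \<beta> l * h l y) + \<epsilon> y" using f by (rule fun_cong)
    ultimately show ?thesis unfolding e_def by linarith
  qed
  obtain g where g: "emp_mean n x \<epsilon> - (olsmc n m h f x - \<mu>) - (\<Sum>j<m. g j * emp_mean n x (k j)) = 0"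
    "\<And>j. j < m \<Longrightarrow> emp_mean n x (\<lambda>y. k j y * \<epsilon> y) - (olsmc n m h f x - \<mu>) * emp_mean n x (k j)
        - (\<Sum>i<m. g i * emp_mean n x (\<lambda>y. k i y * k j y)) = 0"
  proof (rule normal_equations_in_coordinates[OF n k h e_def, where x = x])
    show "(\<Sum>i<n. e (x i)) = 0" "\<And>j. j < m \<Longrightarrow> (\<Sum>i<n. e (x i) * h j (x i)) = 0"
      using b unfolding normal_equations_def e by auto
  qed auto
  show "\<bar>olsmc n m h f x - \<mu> - emp_mean n x \<epsilon>\<bar>
      \<le> 4 * L2_set (\<lambda>j. emp_mean n x (k j)) {..<m} * L2_set (\<lambda>j. emp_mean n x (\<lambda>y. k j y * \<epsilon> y)) {..<m}
        + 2 * L2_set (\<lambda>j. emp_mean n x (k j)) {..<m} * \<bar>emp_mean n x \<epsilon>\<bar>"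
    by (rule normal_equations_perturbation[OF _ gram mean g(1)]) (use g(2) in auto)
qed

section \<open>Random samples\<close>

lemma measurable_emp_mean:
  assumes "\<And>i. i < n \<Longrightarrow> X i \<in> M \<rightarrow>\<^sub>M P" "g \<in> borel_measurable P"
  shows "(\<lambda>\<omega>. emp_mean n (\<lambda>i. X i \<omega>) g) \<in> borel_measurable M"
  unfolding emp_mean_def
  by (intro borel_measurable_divide borel_measurable_sum borel_measurable_const
      measurable_compose[OF assms]) auto

lemma measurable_sample_residual:
  fixes m :: nat
  assumes X: "\<And>i. i < n \<Longrightarrow> X i \<in> M \<rightarrow>\<^sub>M P"
    and "\<And>j. j < m \<Longrightarrow> z j \<in> borel_measurable P" and "u \<in> borel_measurable P" and "i < n"
  shows "(\<lambda>\<omega>. residual (sample_product n (\<lambda>i. X i \<omega>)) z m u (X i \<omega>)) \<in> borel_measurable M"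
  using assms(2-)
proof (induction m arbitrary: u i)
  case 0
  then show ?case using measurable_compose[OF X] by simp
next
  case (Suc m)
  have IH: "(\<lambda>\<omega>. residual (sample_product n (\<lambda>i. X i \<omega>)) z m v (X i \<omega>)) \<in> borel_measurable M"
    if "v \<in> borel_measurable P" "i < n" for v i
    using Suc that by auto
  show ?case
    unfolding residual.simps
    by (intro borel_measurable_diff borel_measurable_times borel_measurable_divide
        borel_measurable_sum IH Suc.prems) auto
qed

lemma measurable_olsmc:
  assumes X: "\<And>i. i < n \<Longrightarrow> X i \<in> M \<rightarrow>\<^sub>M P"
    and h: "\<And>j. j < m \<Longrightarrow> h j \<in> borel_measurable P" and f: "f \<in> borel_measurable P"
  shows "(\<lambda>\<omega>. olsmc n m h f (\<lambda>i. X i \<omega>)) \<in> borel_measurable M"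
    and "{\<omega> \<in> space M. olsmc_well_defined n m h f (\<lambda>i. X i \<omega>)} \<in> sets M"
proof -
  have r: "(\<lambda>\<omega>. intercept_residual n m h (\<lambda>i. X i \<omega>) (X i \<omega>)) \<in> borel_measurable M" if "i < n" for i
    unfolding intercept_residual_def
    by (rule measurable_sample_residual[OF X]) (use h that in \<open>auto simp: regressors_def\<close>)
  have rr: "(\<lambda>\<omega>. \<Sum>i<n. (intercept_residual n m h (\<lambda>i. X i \<omega>) (X i \<omega>))\<^sup>2) \<in> borel_measurable M"
    using r by (intro borel_measurable_sum borel_measurable_power) auto
  show "(\<lambda>\<omega>. olsmc n m h f (\<lambda>i. X i \<omega>)) \<in> borel_measurable M"
    unfolding olsmc_eq_quotient
    using r rr measurable_compose[OF X f]
    by (intro borel_measurable_divide borel_measurable_sum borel_measurable_times) auto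
  show "{\<omega> \<in> space M. olsmc_well_defined n m h f (\<lambda>i. X i \<omega>)} \<in> sets M"
    unfolding olsmc_well_defined_iff using rr by measurable
qed

text \<open>
  Expanding the square of the centred sum, independence kills the off-diagonal terms.
\<close>

lemma (in prob_space) sample_mean_square_error:
  fixes X :: "nat \<Rightarrow> 'a \<Rightarrow> 's"
  assumes P: "prob_space P" and indep: "indep_vars (\<lambda>_. P) X {..<n}"
    and dist: "\<And>i. i < n \<Longrightarrow> distr M P (X i) = P" and n: "n > 0" and g: "g \<in> L2 P"
  shows "integrable M (\<lambda>\<omega>. (emp_mean n (\<lambda>i. X i \<omega>) g - integral\<^sup>L P g)\<^sup>2)"
    and "expectation (\<lambda>\<omega>. (emp_mean n (\<lambda>i. X i \<omega>) g - integral\<^sup>L P g)\<^sup>2) \<le> (\<integral>x. (g x)\<^sup>2 \<partial>P) / n"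
proof -
  interpret P: prob_space P by fact
  define c where "c = integral\<^sup>L P g"
  define u where "u = (\<lambda>x. g x - c)"
  define Y where "Y i \<omega> = u (X i \<omega>)" for i \<omega>
  have X: "X i \<in> M \<rightarrow>\<^sub>M P" if "i < n" for i
    using indep that by (auto simp: indep_vars_def)
  have u: "u \<in> L2 P"
    using L2_minus_scaled[OF g P.const_in_L2[of 1], of c] by (simp add: u_def)
  then have um: "u \<in> borel_measurable P" by (simp add: L2_def)
  have u0: "integral\<^sup>L P u = 0"
    using P.L2_integrable[OF g] by (simp add: u_def c_def P.prob_space)
  have uu: "(\<integral>x. (u x)\<^sup>2 \<partial>P) \<le> (\<integral>x. (g x)\<^sup>2 \<partial>P)"
  proof -
    have "(\<integral>x. (u x)\<^sup>2 \<partial>P) = (\<integral>x. (g x)\<^sup>2 + c\<^sup>2 - 2 * c * g x \<partial>P)"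
      by (simp add: u_def power2_diff mult_ac)
    also have "\<dots> = (\<integral>x. (g x)\<^sup>2 \<partial>P) + c\<^sup>2 - 2 * c * c"
      using P.L2_integrable[OF g] g by (simp add: c_def L2_def P.prob_space)
    also have "\<dots> = (\<integral>x. (g x)\<^sup>2 \<partial>P) - c\<^sup>2" by (simp add: power2_eq_square)
    finally show ?thesis by simp
  qed
  have transfer: "integrable M (\<lambda>\<omega>. v (X i \<omega>))" "expectation (\<lambda>\<omega>. v (X i \<omega>)) = integral\<^sup>L P v"
    if "integrable P v" "i < n" for v :: "'s \<Rightarrow> real" and i
  proof -
    show "integrable M (\<lambda>\<omega>. v (X i \<omega>))"
      using that dist[OF that(2)] by (intro integrable_distr[OF X]) auto
    have "integral\<^sup>L (distr M P (X i)) v = expectation (\<lambda>\<omega>. v (X i \<omega>))"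
      using that by (intro integral_distr[OF X]) auto
    then show "expectation (\<lambda>\<omega>. v (X i \<omega>)) = integral\<^sup>L P v"
      using dist[OF that(2)] by simp
  qed
  have Ysq: "integrable M (\<lambda>\<omega>. (Y i \<omega>)\<^sup>2)" "expectation (\<lambda>\<omega>. (Y i \<omega>)\<^sup>2) = (\<integral>x. (u x)\<^sup>2 \<partial>P)"
    if "i < n" for i
    unfolding Y_def using transfer[of "\<lambda>x. (u x)\<^sup>2", OF _ that] u by (auto simp: L2_def)
  have Y1: "integrable M (Y i)" "expectation (Y i) = 0" if "i < n" for i
    unfolding Y_def using transfer[of u, OF P.L2_integrable[OF u] that] u0 by auto
  have YY: "integrable M (\<lambda>\<omega>. Y i \<omega> * Y j \<omega>) \<and>
      expectation (\<lambda>\<omega>. Y i \<omega> * Y j \<omega>) = (if i = j then \<integral>x. (u x)\<^sup>2 \<partial>P else 0)"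
    if ij: "i < n" "j < n" for i j
  proof (cases "i = j")
    case True
    then show ?thesis using Ysq[OF ij(1)] by (simp add: power2_eq_square)
  next
    case False
    have "indep_vars (\<lambda>_. borel) Y {..<n}"
      unfolding Y_def by (rule indep_vars_compose2[OF indep um])
    then have ind: "indep_vars (\<lambda>_. borel) Y {i, j}"
      by (rule indep_vars_subset) (use ij in auto)
    have int: "\<And>l. l \<in> {i, j} \<Longrightarrow> integrable M (Y l)" using Y1 ij by auto
    show ?thesis
      using indep_vars_integrable[OF _ ind int] indep_vars_lebesgue_integral[OF _ ind int]
        Y1[OF ij(1)] False by simp
  qed
  have eq: "(emp_mean n (\<lambda>i. X i \<omega>) g - integral\<^sup>L P g)\<^sup>2
      = (\<Sum>i<n. \<Sum>j<n. Y i \<omega> * Y j \<omega>) / (real n)\<^sup>2" for \<omega>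
  proof -
    have "emp_mean n (\<lambda>i. X i \<omega>) g - integral\<^sup>L P g = (\<Sum>i<n. Y i \<omega>) / real n"
      using n by (simp add: emp_mean_def Y_def u_def c_def sum_subtractf field_simps)
    then show ?thesis by (simp add: power2_eq_square sum_product)
  qed
  show "integrable M (\<lambda>\<omega>. (emp_mean n (\<lambda>i. X i \<omega>) g - integral\<^sup>L P g)\<^sup>2)"
    unfolding eq using YY
    by (intro Bochner_Integration.integrable_divide Bochner_Integration.integrable_sum) auto
  have "expectation (\<lambda>\<omega>. (emp_mean n (\<lambda>i. X i \<omega>) g - integral\<^sup>L P g)\<^sup>2)
      = (\<Sum>i<n. \<Sum>j<n. if i = j then \<integral>x. (u x)\<^sup>2 \<partial>P else 0) / (real n)\<^sup>2"
  proof -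
    have int: "integrable M (\<lambda>\<omega>. Y i \<omega> * Y j \<omega>)" if "i < n" "j < n" for i j
      using YY[OF that] by simp
    have "expectation (\<lambda>\<omega>. \<Sum>i<n. \<Sum>j<n. Y i \<omega> * Y j \<omega>)
        = (\<Sum>i<n. expectation (\<lambda>\<omega>. \<Sum>j<n. Y i \<omega> * Y j \<omega>))"
      using int by (intro Bochner_Integration.integral_sum Bochner_Integration.integrable_sum) auto
    also have "\<dots> = (\<Sum>i<n. \<Sum>j<n. expectation (\<lambda>\<omega>. Y i \<omega> * Y j \<omega>))"
      using int by (intro sum.cong Bochner_Integration.integral_sum) auto
    also have "\<dots> = (\<Sum>i<n. \<Sum>j<n. if i = j then \<integral>x. (u x)\<^sup>2 \<partial>P else 0)"
      using YY by (intro sum.cong) auto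
    finally show ?thesis unfolding eq by simp
  qed
  also have "\<dots> = (\<integral>x. (u x)\<^sup>2 \<partial>P) / n"
    by (simp add: power2_eq_square)
  also have "\<dots> \<le> (\<integral>x. (g x)\<^sup>2 \<partial>P) / n"
    using uu by (intro divide_right_mono) auto
  finally show "expectation (\<lambda>\<omega>. (emp_mean n (\<lambda>i. X i \<omega>) g - integral\<^sup>L P g)\<^sup>2)
      \<le> (\<integral>x. (g x)\<^sup>2 \<partial>P) / n" .
qed

text \<open>
  The mean square errors of a whole family of sample means are controlled by one bound on the pointwise sum
  of squares. This is how bounds on the leverage, which is such a sum, are exploited.
\<close>

lemma (in prob_space) sum_sample_mean_square_error:
  fixes X :: "nat \<Rightarrow> 'a \<Rightarrow> 's"
  assumes P: "prob_space P" and indep: "indep_vars (\<lambda>_. P) X {..<n}"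
    and dist: "\<And>i. i < n \<Longrightarrow> distr M P (X i) = P" and n: "n > 0"
    and g: "\<And>j. j \<in> J \<Longrightarrow> g j \<in> L2 P" "\<And>j. j \<in> J \<Longrightarrow> integral\<^sup>L P (g j) = c j"
    and bound: "integrable P b" "\<And>x. x \<in> space P \<Longrightarrow> (\<Sum>j\<in>J. (g j x)\<^sup>2) \<le> b x"
  shows "integrable M (\<lambda>\<omega>. \<Sum>j\<in>J. (emp_mean n (\<lambda>i. X i \<omega>) (g j) - c j)\<^sup>2)"
    and "expectation (\<lambda>\<omega>. \<Sum>j\<in>J. (emp_mean n (\<lambda>i. X i \<omega>) (g j) - c j)\<^sup>2) \<le> integral\<^sup>L P b / n"
proof -
  note mse = sample_mean_square_error[OF P indep dist n g(1)]
  have int: "integrable M (\<lambda>\<omega>. (emp_mean n (\<lambda>i. X i \<omega>) (g j) - c j)\<^sup>2)" if "j \<in> J" for j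
    using mse(1)[OF _ that] g(2)[OF that] by simp
  then show "integrable M (\<lambda>\<omega>. \<Sum>j\<in>J. (emp_mean n (\<lambda>i. X i \<omega>) (g j) - c j)\<^sup>2)"
    by (intro Bochner_Integration.integrable_sum)
  have "expectation (\<lambda>\<omega>. \<Sum>j\<in>J. (emp_mean n (\<lambda>i. X i \<omega>) (g j) - c j)\<^sup>2)
      = (\<Sum>j\<in>J. expectation (\<lambda>\<omega>. (emp_mean n (\<lambda>i. X i \<omega>) (g j) - c j)\<^sup>2))"
    using int by (intro Bochner_Integration.integral_sum)
  also have "\<dots> \<le> (\<Sum>j\<in>J. (\<integral>x. (g j x)\<^sup>2 \<partial>P) / n)"
    using mse(2) g(2) by (intro sum_mono) auto
  also have "\<dots> = (\<integral>x. (\<Sum>j\<in>J. (g j x)\<^sup>2) \<partial>P) / n"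
    using g(1) by (simp add: sum_divide_distrib Bochner_Integration.integral_sum L2_def)
  also have "\<dots> \<le> integral\<^sup>L P b / n"
    using bound g(1)
    by (intro divide_right_mono integral_mono Bochner_Integration.integrable_sum) (auto simp: L2_def)
  finally show "expectation (\<lambda>\<omega>. \<Sum>j\<in>J. (emp_mean n (\<lambda>i. X i \<omega>) (g j) - c j)\<^sup>2) \<le> integral\<^sup>L P b / n" .
qed

section \<open>Non-asymptotic bounds\<close>

lemma L2_bounded_mult:
  assumes u: "u \<in> borel_measurable P" "\<And>x. x \<in> space P \<Longrightarrow> (u x)\<^sup>2 \<le> K" and v: "v \<in> L2 P"
  shows "(\<lambda>x. u x * v x) \<in> L2 P"
proof -
  have "integrable P (\<lambda>x. (u x * v x)\<^sup>2)"
  proof (rule Bochner_Integration.integrable_bound)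
    show "integrable P (\<lambda>x. K * (v x)\<^sup>2)" using v by (simp add: L2_def)
    show "(\<lambda>x. (u x * v x)\<^sup>2) \<in> borel_measurable P"
      using u v by (auto simp: L2_def intro!: borel_measurable_power borel_measurable_times)
    show "AE x in P. norm ((u x * v x)\<^sup>2) \<le> norm (K * (v x)\<^sup>2)"
    proof (intro AE_I2)
      fix x assume "x \<in> space P"
      then have "(u x)\<^sup>2 * (v x)\<^sup>2 \<le> K * (v x)\<^sup>2" by (intro mult_right_mono u) auto
      then show "norm ((u x * v x)\<^sup>2) \<le> norm (K * (v x)\<^sup>2)"
        by (simp add: power_mult_distrib)
    qed
  qed
  then show ?thesis using u v by (auto simp: L2_def intro!: borel_measurable_times)
qed

text \<open>
  The factors on the right are normalised so that, for \<open>p\<close>, \<open>\<nu>\<close>, \<open>w\<close> the norms of \<open>P\<^sub>n(k)\<close> and \<open>P\<^sub>n(k \<epsilon>)\<close> and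
  the mean \<open>P\<^sub>n(\<epsilon>)\<close>, each of the three scaled squares has expectation at most 1. Products are split by
  \<open>2 a b \<le> a\<^sup>2 + b\<^sup>2\<close>, and \<open>K \<ge> 1\<close> replaces \<open>m / n\<close> by \<open>K m / n\<close>.
\<close>

lemma rescaled_linearization_error:
  fixes n m K \<sigma> p \<nu> w \<Delta> :: real
  assumes pos: "n > 0" "m > 0" "K \<ge> 1" "\<sigma> > 0" and nn: "p \<ge> 0" "\<nu> \<ge> 0"
    and err: "\<bar>\<Delta>\<bar> \<le> 4 * p * \<nu> + 2 * p * \<bar>w\<bar>"
  shows "\<bar>sqrt n / \<sigma> * \<Delta>\<bar>
    \<le> sqrt (K * m / n) * (3 * (n / m * p\<^sup>2) + 2 * (n / (K * \<sigma>\<^sup>2) * \<nu>\<^sup>2) + n / \<sigma>\<^sup>2 * w\<^sup>2)"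
proof -
  define a b c where "a = p * sqrt n / sqrt m" "b = \<nu> * sqrt n / (\<sigma> * sqrt K)" "c = \<bar>w\<bar> * sqrt n / \<sigma>"
  note defs = a_b_c_def
  have sq: "n / m * p\<^sup>2 = a\<^sup>2" "n / (K * \<sigma>\<^sup>2) * \<nu>\<^sup>2 = b\<^sup>2" "n / \<sigma>\<^sup>2 * w\<^sup>2 = c\<^sup>2"
    using pos by (simp_all add: defs power_mult_distrib power_divide mult_ac)
  have nonneg: "a \<ge> 0" "b \<ge> 0" "c \<ge> 0" using pos nn by (simp_all add: defs)
  have r: "sqrt (m / n) \<le> sqrt (K * m / n)"
    using pos mult_right_mono[of 1 K "m / n"] by simp
  have pn: "sqrt n / \<sigma> * (p * \<nu>) = sqrt (K * m / n) * (a * b)"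
    "sqrt n / \<sigma> * (p * \<bar>w\<bar>) = sqrt (m / n) * (a * c)"
    using pos by (simp_all add: defs real_sqrt_mult real_sqrt_divide field_simps)
  have "\<bar>sqrt n / \<sigma> * \<Delta>\<bar> = sqrt n / \<sigma> * \<bar>\<Delta>\<bar>" using pos by (simp add: abs_mult)
  also have "\<dots> \<le> sqrt n / \<sigma> * (4 * p * \<nu> + 2 * p * \<bar>w\<bar>)"
    using err pos by (intro mult_left_mono) auto
  also have "\<dots> = 4 * (sqrt n / \<sigma> * (p * \<nu>)) + 2 * (sqrt n / \<sigma> * (p * \<bar>w\<bar>))"
    by (simp add: algebra_simps)
  also have "\<dots> = 4 * (sqrt (K * m / n) * (a * b)) + 2 * (sqrt (m / n) * (a * c))"
    unfolding pn ..
  also have "\<dots> \<le> 4 * (sqrt (K * m / n) * (a * b)) + 2 * (sqrt (K * m / n) * (a * c))"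
    using r nonneg by (intro add_left_mono mult_left_mono mult_right_mono) auto
  also have "\<dots> = sqrt (K * m / n) * (4 * (a * b) + 2 * (a * c))" by (simp add: algebra_simps)
  also have "\<dots> \<le> sqrt (K * m / n) * (3 * a\<^sup>2 + 2 * b\<^sup>2 + c\<^sup>2)"
    using sum_squares_bound[of a b] sum_squares_bound[of a c] pos
    by (intro mult_left_mono) auto
  finally show ?thesis unfolding sq .
qed

text \<open>
  One row of the triangular array, with a finite bound \<open>K\<close> on the leverage.
\<close>

locale bounded_leverage_sample = prob_space M + P: prob_space P
  for M :: "'w measure" and P :: "'s measure" +
  fixes X :: "nat \<Rightarrow> 'w \<Rightarrow> 's" and n m :: nat and h :: "nat \<Rightarrow> 's \<Rightarrow> real" and f :: "'s \<Rightarrow> real"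
    and K :: real
  assumes indep: "indep_vars (\<lambda>_. P) X {..<n}"
    and dist: "\<And>i. i < n \<Longrightarrow> distr M P (X i) = P"
    and n: "n > 0" and m: "m > 0"
    and h_L2: "\<And>j. j < m \<Longrightarrow> h j \<in> L2 P"
    and h_mean: "\<And>j. j < m \<Longrightarrow> integral\<^sup>L P (h j) = 0"
    and h_indep: "lin_indep_L2 P m h"
    and f_L2: "f \<in> L2 P"
    and sd_pos: "resid_sd P m h f > 0"
    and leverage_le: "\<And>x. x \<in> space P \<Longrightarrow> leverage P m h x \<le> K"
begin

abbreviation "\<epsilon> \<equiv> resid P m h f"
abbreviation "\<sigma> \<equiv> resid_sd P m h f"
abbreviation "\<rho> \<equiv> K * real m / real n"
abbreviation "scaled_mean \<omega> \<equiv> sqrt (real n) / \<sigma> * emp_mean n (\<lambda>i. X i \<omega>) \<epsilon>"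
abbreviation "scaled_error \<omega> \<equiv>
  sqrt (real n) / \<sigma> * (olsmc n m h f (\<lambda>i. X i \<omega>) - integral\<^sup>L P f)"

lemma X_measurable: "i < n \<Longrightarrow> X i \<in> M \<rightarrow>\<^sub>M P"
  using indep by (auto simp: indep_vars_def)

lemma measurable_estimators [measurable]:
  "scaled_mean \<in> borel_measurable M"
  "scaled_error \<in> borel_measurable M"
  "{\<omega> \<in> space M. olsmc_well_defined n m h f (\<lambda>i. X i \<omega>)} \<in> sets M"
proof -
  have \<epsilon>: "\<epsilon> \<in> L2 P" by (rule P.resid_properties[OF h_L2 h_mean h_indep f_L2])
  have "(\<lambda>\<omega>. emp_mean n (\<lambda>i. X i \<omega>) \<epsilon>) \<in> borel_measurable M"
    by (rule measurable_emp_mean[OF X_measurable]) (use \<epsilon> in \<open>auto simp: L2_def\<close>)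
  then show "scaled_mean \<in> borel_measurable M"
    by simp
  have "h j \<in> borel_measurable P" if "j < m" for j
    using h_L2[OF that] by (simp add: L2_def)
  moreover have "f \<in> borel_measurable P"
    using f_L2 by (simp add: L2_def)
  ultimately have ols: "(\<lambda>\<omega>. olsmc n m h f (\<lambda>i. X i \<omega>)) \<in> borel_measurable M"
    "{\<omega> \<in> space M. olsmc_well_defined n m h f (\<lambda>i. X i \<omega>)} \<in> sets M"
    by (auto intro!: measurable_olsmc[where P = P] X_measurable)
  show "scaled_error \<in> borel_measurable M"
    using ols(1) by simp
  show "{\<omega> \<in> space M. olsmc_well_defined n m h f (\<lambda>i. X i \<omega>)} \<in> sets M"
    by (rule ols(2))
qed

lemma sd_square: "\<sigma>\<^sup>2 = (\<integral>x. (\<epsilon> x)\<^sup>2 \<partial>P)"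
  unfolding resid_sd_def by simp

lemma residual_mean_square:
  "integrable M (\<lambda>\<omega>. (scaled_mean \<omega>)\<^sup>2)" "expectation (\<lambda>\<omega>. (scaled_mean \<omega>)\<^sup>2) \<le> 1"
proof -
  note \<epsilon> = P.resid_properties[OF h_L2 h_mean h_indep f_L2]
  note mse = sample_mean_square_error[OF P.prob_space_axioms indep dist n \<epsilon>(1)]
  have eq: "(scaled_mean \<omega>)\<^sup>2 = real n / \<sigma>\<^sup>2 * (emp_mean n (\<lambda>i. X i \<omega>) \<epsilon> - integral\<^sup>L P \<epsilon>)\<^sup>2" for \<omega>
    by (simp add: \<epsilon>(2) power_mult_distrib power_divide)
  show "integrable M (\<lambda>\<omega>. (scaled_mean \<omega>)\<^sup>2)"
    unfolding eq using mse(1) by simp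
  have "expectation (\<lambda>\<omega>. (scaled_mean \<omega>)\<^sup>2)
      = real n / \<sigma>\<^sup>2 * expectation (\<lambda>\<omega>. (emp_mean n (\<lambda>i. X i \<omega>) \<epsilon> - integral\<^sup>L P \<epsilon>)\<^sup>2)"
    unfolding eq by simp
  also have "\<dots> \<le> real n / \<sigma>\<^sup>2 * (\<sigma>\<^sup>2 / n)"
    unfolding sd_square using mse(2) by (intro mult_left_mono) auto
  also have "\<dots> = 1" using n sd_pos by simp
  finally show "expectation (\<lambda>\<omega>. (scaled_mean \<omega>)\<^sup>2) \<le> 1" .
qed

text \<open>
  \<open>D\<close> measures how far the sample moments of the orthonormal controls are from their population values:
  squared distance of the Gram matrix plus squared norm of the means, with expectation at most
  \<open>K m/n + m/n\<close>. \<open>Z\<close> is the random factor of \<open>rescaled_linearization_error\<close>, with expectation at most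
  \<open>3 + 2 + 1\<close>.
\<close>

lemma linearization_dominated:
  obtains D Z where
    "integrable M D" "\<And>\<omega>. D \<omega> \<ge> 0" "expectation D \<le> 2 * \<rho>"
    "integrable M Z" "\<And>\<omega>. Z \<omega> \<ge> 0" "expectation Z \<le> 6"
    "\<And>\<omega>. D \<omega> < 1/4 \<Longrightarrow> olsmc_well_defined n m h f (\<lambda>i. X i \<omega>)"
    "\<And>\<omega>. D \<omega> < 1/4 \<Longrightarrow> \<bar>scaled_error \<omega> - scaled_mean \<omega>\<bar> \<le> sqrt \<rho> * Z \<omega>"
proof -
  note \<epsilon> = P.resid_properties[OF h_L2 h_mean h_indep f_L2]
  obtain k T where k: "\<And>j. j < m \<Longrightarrow> k j = (\<lambda>x. \<Sum>l<m. T j l * h l x)"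
    and ortho: "\<And>i j. i < m \<Longrightarrow> j < m \<Longrightarrow> L2_product P (k i) (k j) = (if i = j then 1 else 0)"
    using orthonormal_controls[OF h_L2 h_indep] by blast
  obtain S where S: "\<And>l x. l < m \<Longrightarrow> h l x = (\<Sum>j<m. S l j * k j x)"
    using leverage_orthonormal(2)[OF h_L2 k ortho] by blast
  have lev: "(\<Sum>j<m. (k j x)\<^sup>2) \<le> K" if "x \<in> space P" for x
    using leverage_le[OF that] leverage_orthonormal(1)[OF h_L2 k ortho] by simp
  have kL2: "k j \<in> L2 P" if "j < m" for j
    using L2_combination(1)[where c = "T j" and m = m and h = h, OF h_L2 f_L2] k[OF that] by simp
  have k_mean: "integral\<^sup>L P (k j) = 0" if "j < m" for j
    using L2_combination(2)[where c = "T j" and m = m and h = h, OF h_L2 P.const_in_L2[of 1]] k[OF that] h_mean by simp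
  have k\<epsilon>_mean: "L2_product P (k j) \<epsilon> = 0" if "j < m" for j
  proof -
    have "L2_product P (k j) \<epsilon> = (\<Sum>l<m. T j l * L2_product P (h l) \<epsilon>)"
      unfolding k[OF that] by (rule L2_combination(2)[OF h_L2 \<epsilon>(1)])
    also have "\<dots> = 0"
      using \<epsilon>(3) L2.commute[OF h_L2 \<epsilon>(1)] by (intro sum.neutral) auto
    finally show ?thesis .
  qed
  have k_le: "(k j x)\<^sup>2 \<le> K" if "j < m" "x \<in> space P" for j x
    using member_le_sum[of j "{..<m}" "\<lambda>j. (k j x)\<^sup>2"] lev[OF that(2)] that by fastforce
  have k_mult_L2: "(\<lambda>x. k i x * v x) \<in> L2 P" if "i < m" "v \<in> L2 P" for i v
    using kL2[OF that(1)] that(2) k_le[OF that(1)]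
    by (intro L2_bounded_mult[where K = K]) (auto simp: L2_def)
  have int_q: "integrable P (\<lambda>x. \<Sum>j<m. (k j x)\<^sup>2)" "(\<integral>x. (\<Sum>j<m. (k j x)\<^sup>2) \<partial>P) = m"
  proof -
    have int: "integrable P (\<lambda>x. (k j x)\<^sup>2)" if "j < m" for j
      using kL2[OF that] by (simp add: L2_def)
    then show "integrable P (\<lambda>x. \<Sum>j<m. (k j x)\<^sup>2)" by auto
    have "(\<integral>x. (\<Sum>j<m. (k j x)\<^sup>2) \<partial>P) = (\<Sum>j<m. \<integral>x. (k j x)\<^sup>2 \<partial>P)"
      using int by (intro Bochner_Integration.integral_sum) auto
    also have "\<dots> = (\<Sum>j<m. 1)"
      using ortho by (intro sum.cong) (auto simp: power2_eq_square)
    finally show "(\<integral>x. (\<Sum>j<m. (k j x)\<^sup>2) \<partial>P) = m" by simp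
  qed
  \<comment> \<open>The leverage has mean \<open>m\<close>, so its upper bound is at least \<open>m\<close>.\<close>
  have "real m \<le> K"
    using integral_mono[OF int_q(1), of "\<lambda>_. K"] lev int_q(2) by (simp add: P.prob_space)
  then have K: "K \<ge> 1" using m by simp

  define x where "x \<omega> i = X i \<omega>" for \<omega> i
  define A where "A \<omega> = (\<Sum>j<m. (emp_mean n (x \<omega>) (k j))\<^sup>2)" for \<omega>
  define V where "V \<omega> = (\<Sum>j<m. (emp_mean n (x \<omega>) (\<lambda>y. k j y * \<epsilon> y))\<^sup>2)" for \<omega>
  define G where "G \<omega> = (\<Sum>i<m. \<Sum>j<m.
      (emp_mean n (x \<omega>) (\<lambda>y. k i y * k j y) - (if i = j then 1 else 0))\<^sup>2)" for \<omega>
  note mse = sum_sample_mean_square_error[OF P.prob_space_axioms indep dist n]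
  have A: "integrable M A" "expectation A \<le> m / n"
    using mse[OF _ kL2 k_mean int_q(1), of "{..<m}"] int_q(2)
    unfolding A_def x_def by auto
  have V: "integrable M V" "expectation V \<le> K * \<sigma>\<^sup>2 / n"
  proof -
    have b: "integrable P (\<lambda>x. K * (\<epsilon> x)\<^sup>2)" using \<epsilon>(1) by (simp add: L2_def)
    have le: "(\<Sum>j<m. (k j x * \<epsilon> x)\<^sup>2) \<le> K * (\<epsilon> x)\<^sup>2" if "x \<in> space P" for x
      unfolding power_mult_distrib sum_distrib_right[symmetric]
      by (intro mult_right_mono lev that) auto
    show "integrable M V" "expectation V \<le> K * \<sigma>\<^sup>2 / n"
      using mse[where J = "{..<m}" and g = "\<lambda>j x. k j x * \<epsilon> x" and c = "\<lambda>_. 0", OF _ _ _ b le]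
        k_mult_L2 \<epsilon>(1) k\<epsilon>_mean
      unfolding V_def x_def sd_square by auto
  qed
  have G: "integrable M G" "expectation G \<le> \<rho>"
  proof -
    have b: "integrable P (\<lambda>x. K * (\<Sum>j<m. (k j x)\<^sup>2))" using int_q(1) by simp
    have le: "(\<Sum>ij\<in>{..<m} \<times> {..<m}. (k (fst ij) x * k (snd ij) x)\<^sup>2) \<le> K * (\<Sum>j<m. (k j x)\<^sup>2)"
      if "x \<in> space P" for x
    proof -
      have "(\<Sum>ij\<in>{..<m} \<times> {..<m}. (k (fst ij) x * k (snd ij) x)\<^sup>2)
          = (\<Sum>i<m. (k i x)\<^sup>2) * (\<Sum>j<m. (k j x)\<^sup>2)"
        by (simp add: power_mult_distrib sum_product sum.cartesian_product case_prod_beta)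
      also have "\<dots> \<le> K * (\<Sum>j<m. (k j x)\<^sup>2)"
        by (intro mult_right_mono lev that sum_nonneg) auto
      finally show ?thesis .
    qed
    have G_eq: "G = (\<lambda>\<omega>. \<Sum>ij\<in>{..<m} \<times> {..<m}.
        (emp_mean n (\<lambda>i. X i \<omega>) (\<lambda>y. k (fst ij) y * k (snd ij) y)
          - (if fst ij = snd ij then 1 else 0))\<^sup>2)"
      by (rule ext) (simp add: G_def x_def[abs_def] sum.cartesian_product case_prod_beta)
    show "integrable M G" "expectation G \<le> \<rho>"
      using mse[where J = "{..<m} \<times> {..<m}" and g = "\<lambda>ij x. k (fst ij) x * k (snd ij) x"
          and c = "\<lambda>ij. if fst ij = snd ij then 1 else 0", OF _ _ _ b le]
        k_mult_L2 kL2 ortho int_q(2)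
      unfolding G_eq by auto
  qed
  show thesis
  proof
    define D where "D \<omega> = G \<omega> + A \<omega>" for \<omega>
    define Z where "Z \<omega> = 3 * (n / m * A \<omega>) + 2 * (n / (K * \<sigma>\<^sup>2) * V \<omega>) + (scaled_mean \<omega>)\<^sup>2" for \<omega>
    have nonneg: "A \<omega> \<ge> 0" "V \<omega> \<ge> 0" "G \<omega> \<ge> 0" for \<omega>
      by (simp_all add: A_def V_def G_def sum_nonneg)
    show "integrable M D" "integrable M Z"
      unfolding D_def Z_def using A V G residual_mean_square(1) by auto
    show "\<And>\<omega>. D \<omega> \<ge> 0" "\<And>\<omega>. Z \<omega> \<ge> 0"
      using nonneg K by (simp_all add: D_def Z_def)
    have "real m / n \<le> \<rho>"
      using mult_right_mono[OF K, of "real m"] by (intro divide_right_mono) auto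
    then show "expectation D \<le> 2 * \<rho>"
      unfolding D_def using A G by simp
    have "n / m * expectation A \<le> 1"
      using mult_left_mono[OF A(2), of "n / m"] n m by simp
    moreover have "n / (K * \<sigma>\<^sup>2) * expectation V \<le> 1"
      using mult_left_mono[OF V(2), of "n / (K * \<sigma>\<^sup>2)"] n K sd_pos by simp
    moreover have "expectation Z
        = 3 * (n / m * expectation A) + 2 * (n / (K * \<sigma>\<^sup>2) * expectation V)
          + expectation (\<lambda>\<omega>. (scaled_mean \<omega>)\<^sup>2)"
      unfolding Z_def using A V residual_mean_square(1) by simp
    ultimately show "expectation Z \<le> 6"
      using residual_mean_square(2) by linarith
    fix \<omega> assume "D \<omega> < 1/4"
    then have small: "G \<omega> \<le> 1/4" "A \<omega> \<le> 1/4" using nonneg[of \<omega>] by (auto simp: D_def)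
    define \<beta> where "\<beta> l = proj_coef P m h f $ l" for l
    have f: "f = (\<lambda>y. integral\<^sup>L P f + (\<Sum>l<m. \<beta> l * h l y) + \<epsilon> y)"
      by (simp add: resid_def scalar_prod_control_vec \<beta>_def)
    note lin = olsmc_linearization_error[OF n k S small[unfolded G_def A_def] f]
    show "olsmc_well_defined n m h f (\<lambda>i. X i \<omega>)"
      using lin(1) by (simp add: x_def[abs_def])
    define a where "a = L2_set (\<lambda>j. emp_mean n (x \<omega>) (k j)) {..<m}"
    define v where "v = L2_set (\<lambda>j. emp_mean n (x \<omega>) (\<lambda>y. k j y * \<epsilon> y)) {..<m}"
    have sq: "A \<omega> = a\<^sup>2" "V \<omega> = v\<^sup>2"
      by (simp_all add: A_def V_def a_def v_def L2_set_def sum_nonneg)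
    have "\<bar>sqrt n / \<sigma> * (olsmc n m h f (x \<omega>) - integral\<^sup>L P f - emp_mean n (x \<omega>) \<epsilon>)\<bar>
        \<le> sqrt \<rho> * (3 * (n / m * a\<^sup>2) + 2 * (n / (K * \<sigma>\<^sup>2) * v\<^sup>2) + n / \<sigma>\<^sup>2 * (emp_mean n (x \<omega>) \<epsilon>)\<^sup>2)"
      using lin(2) n m K sd_pos
      by (intro rescaled_linearization_error) (auto simp: a_def v_def)
    moreover have "n / \<sigma>\<^sup>2 * (emp_mean n (x \<omega>) \<epsilon>)\<^sup>2 = (scaled_mean \<omega>)\<^sup>2"
      by (simp add: x_def[abs_def] power_mult_distrib power_divide)
    ultimately show "\<bar>scaled_error \<omega> - scaled_mean \<omega>\<bar> \<le> sqrt \<rho> * Z \<omega>"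
      by (simp add: Z_def sq x_def[abs_def] right_diff_distrib)
  qed
qed

lemma markov:
  assumes "integrable M u" "\<And>\<omega>. u \<omega> \<ge> 0" "expectation u \<le> b" "c > 0"
  shows "prob {\<omega> \<in> space M. u \<omega> \<ge> c} \<le> b / c"
  using integral_Markov_inequality_measure[OF assms(1), of "{}" c] assms
    divide_right_mono[of "expectation u" b c] by force

lemma finite_sample_bounds:
  shows prob_not_well_defined:
      "prob {\<omega> \<in> space M. \<not> olsmc_well_defined n m h f (\<lambda>i. X i \<omega>)} \<le> 8 * \<rho>"
    and prob_linearization_error: "\<eta> > 0 \<Longrightarrow>
      prob {\<omega> \<in> space M. \<bar>scaled_error \<omega> - scaled_mean \<omega>\<bar> > \<eta>} \<le> 8 * \<rho> + 6 * sqrt \<rho> / \<eta>"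
    and prob_scaled_mean: "C > 0 \<Longrightarrow> prob {\<omega> \<in> space M. \<bar>scaled_mean \<omega>\<bar> > C} \<le> 1 / C\<^sup>2"
proof -
  obtain D Z where
    D: "integrable M D" "\<And>\<omega>. D \<omega> \<ge> 0" "expectation D \<le> 2 * \<rho>" and
    Z: "integrable M Z" "\<And>\<omega>. Z \<omega> \<ge> 0" "expectation Z \<le> 6" and
    wd: "\<And>\<omega>. D \<omega> < 1/4 \<Longrightarrow> olsmc_well_defined n m h f (\<lambda>i. X i \<omega>)" and
    err: "\<And>\<omega>. D \<omega> < 1/4 \<Longrightarrow> \<bar>scaled_error \<omega> - scaled_mean \<omega>\<bar> \<le> sqrt \<rho> * Z \<omega>"
    using linearization_dominated by blast
  note [measurable] = borel_measurable_integrable[OF D(1)] borel_measurable_integrable[OF Z(1)]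
  have PD: "prob {\<omega> \<in> space M. D \<omega> \<ge> 1/4} \<le> 8 * \<rho>"
    using markov[OF D, of "1/4"] by simp
  have "prob {\<omega> \<in> space M. \<not> olsmc_well_defined n m h f (\<lambda>i. X i \<omega>)}
      \<le> prob {\<omega> \<in> space M. D \<omega> \<ge> 1/4}"
    using wd by (intro finite_measure_mono) (auto simp: not_less[symmetric])
  then show "prob {\<omega> \<in> space M. \<not> olsmc_well_defined n m h f (\<lambda>i. X i \<omega>)} \<le> 8 * \<rho>"
    using PD by simp
  show "prob {\<omega> \<in> space M. \<bar>scaled_error \<omega> - scaled_mean \<omega>\<bar> > \<eta>} \<le> 8 * \<rho> + 6 * sqrt \<rho> / \<eta>"
    if \<eta>: "\<eta> > 0"
  proof -
    have "expectation D \<ge> 0" using D by (intro integral_nonneg_AE) auto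
    then have \<rho>: "\<rho> \<ge> 0" using D(3) by linarith
    have PZ: "prob {\<omega> \<in> space M. sqrt \<rho> * Z \<omega> \<ge> \<eta>} \<le> 6 * sqrt \<rho> / \<eta>"
    proof (rule markov[OF _ _ _ \<eta>])
      show "integrable M (\<lambda>\<omega>. sqrt \<rho> * Z \<omega>)" using Z by simp
      show "sqrt \<rho> * Z \<omega> \<ge> 0" for \<omega> using Z \<rho> by (intro mult_nonneg_nonneg) auto
      show "expectation (\<lambda>\<omega>. sqrt \<rho> * Z \<omega>) \<le> 6 * sqrt \<rho>"
        using mult_left_mono[OF Z(3), of "sqrt \<rho>"] \<rho> by (simp add: mult.commute)
    qed
    have "{\<omega> \<in> space M. \<bar>scaled_error \<omega> - scaled_mean \<omega>\<bar> > \<eta>}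
        \<subseteq> {\<omega> \<in> space M. D \<omega> \<ge> 1/4} \<union> {\<omega> \<in> space M. sqrt \<rho> * Z \<omega> \<ge> \<eta>}"
    proof
      fix \<omega> assume "\<omega> \<in> {\<omega> \<in> space M. \<bar>scaled_error \<omega> - scaled_mean \<omega>\<bar> > \<eta>}"
      then show "\<omega> \<in> {\<omega> \<in> space M. D \<omega> \<ge> 1/4} \<union> {\<omega> \<in> space M. sqrt \<rho> * Z \<omega> \<ge> \<eta>}"
        using err[of \<omega>] by (cases "D \<omega> < 1/4") auto
    qed
    then have "prob {\<omega> \<in> space M. \<bar>scaled_error \<omega> - scaled_mean \<omega>\<bar> > \<eta>}
        \<le> prob ({\<omega> \<in> space M. D \<omega> \<ge> 1/4} \<union> {\<omega> \<in> space M. sqrt \<rho> * Z \<omega> \<ge> \<eta>})"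
      by (rule finite_measure_mono) measurable
    also have "\<dots> \<le> prob {\<omega> \<in> space M. D \<omega> \<ge> 1/4} + prob {\<omega> \<in> space M. sqrt \<rho> * Z \<omega> \<ge> \<eta>}"
      by (rule measure_Un_le) measurable
    finally show ?thesis using PD PZ by linarith
  qed
  show "prob {\<omega> \<in> space M. \<bar>scaled_mean \<omega>\<bar> > C} \<le> 1 / C\<^sup>2" if C: "C > 0"
  proof -
    have "prob {\<omega> \<in> space M. \<bar>scaled_mean \<omega>\<bar> > C} \<le> prob {\<omega> \<in> space M. (scaled_mean \<omega>)\<^sup>2 \<ge> C\<^sup>2}"
    proof (rule finite_measure_mono)
      show "{\<omega> \<in> space M. \<bar>scaled_mean \<omega>\<bar> > C} \<subseteq> {\<omega> \<in> space M. (scaled_mean \<omega>)\<^sup>2 \<ge> C\<^sup>2}"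
        using C by (auto simp: abs_le_square_iff[symmetric] simp del: power_mult_distrib)
    qed measurable
    also have "\<dots> \<le> 1 / C\<^sup>2"
      using C residual_mean_square by (intro markov) auto
    finally show ?thesis .
  qed
qed

end

section \<open>Asymptotics\<close>

text \<open>
  A finite ratio forces a finite supremum, because the denominator is positive; a value \<open>-\<infinity>\<close> is excluded
  because the space is nonempty.
\<close>

lemma (in prob_space) real_bound_of_ereal_SUP:
  fixes g :: "'a \<Rightarrow> real" and r :: real
  assumes r: "r > 0" and fin: "(SUP x\<in>space M. ereal (g x)) / ereal r < \<infinity>"
  obtains K where "\<And>x. x \<in> space M \<Longrightarrow> g x \<le> K"
    "(SUP x\<in>space M. ereal (g x)) / ereal r = ereal (K / r)"
proof -
  define s where "s = (SUP x\<in>space M. ereal (g x))"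
  have le: "ereal (g x) \<le> s" if "x \<in> space M" for x
    unfolding s_def using that by (rule SUP_upper)
  obtain x0 where x0: "x0 \<in> space M" using not_empty by blast
  obtain K where K: "s = ereal K"
    using le[OF x0] fin r unfolding s_def[symmetric] by (cases s) auto
  show thesis
  proof
    show "\<And>x. x \<in> space M \<Longrightarrow> g x \<le> K" using le K by auto
    show "(SUP x\<in>space M. ereal (g x)) / ereal r = ereal (K / r)"
      using K r by (simp add: s_def)
  qed
qed

theorem theorem1:
  fixes P :: "'s measure" and M :: "'w measure"
    and X :: "nat \<Rightarrow> nat \<Rightarrow> 'w \<Rightarrow> 's"
    and m :: "nat \<Rightarrow> nat"
    and h :: "nat \<Rightarrow> nat \<Rightarrow> 's \<Rightarrow> real"
    and f :: "nat \<Rightarrow> 's \<Rightarrow> real"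
  defines "\<mu> \<equiv> \<lambda>n. integral\<^sup>L P (f n)"
    and "\<epsilon> \<equiv> \<lambda>n. resid P (m n) (h n) (f n)"
    and "\<sigma> \<equiv> \<lambda>n. resid_sd P (m n) (h n) (f n)"
    and "\<mu>hat \<equiv> \<lambda>n \<omega>. olsmc n (m n) (h n) (f n) (\<lambda>i. X n i \<omega>)"
  assumes "prob_space P" and "prob_space M"
    and "\<And>n. prob_space.indep_vars M (\<lambda>_. P) (X n) {..<n}"
    and "\<And>n i. i < n \<Longrightarrow> distr M P (X n i) = P"
    and "\<And>n. m n > 0" and "filterlim m at_top sequentially"
    and "\<And>n j. j < m n \<Longrightarrow> h n j \<in> L2 P"
    and "\<And>n j. j < m n \<Longrightarrow> integral\<^sup>L P (h n j) = 0"
    and "\<And>n. lin_indep_L2 P (m n) (h n)"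
    and "\<And>n. f n \<in> L2 P"
    and "\<And>n. (\<sigma> n)\<^sup>2 > 0"
    and "(\<lambda>n. (SUP x\<in>space P. ereal (leverage P (m n) (h n) x)) / ereal (real n / real (m n)))
           \<longlonglongrightarrow> 0"
  shows "(\<lambda>n. measure M {\<omega> \<in> space M.
              olsmc_well_defined n (m n) (h n) (f n) (\<lambda>i. X n i \<omega>)}) \<longlonglongrightarrow> 1 \<and>
         little_oP M (\<lambda>n \<omega>. sqrt (real n) / \<sigma> n * (\<mu>hat n \<omega> - \<mu> n)
            - sqrt (real n) / \<sigma> n * emp_mean n (\<lambda>i. X n i \<omega>) (\<epsilon> n)) (\<lambda>_. 1) \<and>
         big_OP M (\<lambda>n \<omega>. sqrt (real n) / \<sigma> n * (\<mu>hat n \<omega> - \<mu> n)) (\<lambda>_. 1) \<and>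
         big_OP M (\<lambda>n \<omega>. \<mu>hat n \<omega> - \<mu> n) (\<lambda>n. \<sigma> n / sqrt (real n))"
proof -
  interpret prob_space M by fact
  interpret P: prob_space P by fact
  note indep = assms(7) and dist = assms(8) and m = assms(9)
    and h_L2 = assms(11) and h_mean = assms(12) and h_indep = assms(13) and f_L2 = assms(14)
    and lim = assms(16)
  have sd: "\<sigma> n > 0" for n
    using assms(15)[of n] by (auto simp: \<sigma>_def resid_sd_def)
  define ratio where
    "ratio n = (SUP x\<in>space P. ereal (leverage P (m n) (h n) x)) / ereal (real n / real (m n))" for n
  define \<rho> where "\<rho> n = real_of_ereal (ratio n)" for n
  define T where "T n \<omega> = sqrt (real n) / \<sigma> n * (\<mu>hat n \<omega> - \<mu> n)" for n \<omega>
  define W where "W n \<omega> = sqrt (real n) / \<sigma> n * emp_mean n (\<lambda>i. X n i \<omega>) (\<epsilon> n)" for n \<omega>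
  define bad where "bad n = {\<omega> \<in> space M. \<not> olsmc_well_defined n (m n) (h n) (f n) (\<lambda>i. X n i \<omega>)}" for n
  have \<rho>_lim: "\<rho> \<longlonglongrightarrow> 0"
    using lim_real_of_ereal[of ratio 0 sequentially] lim
    unfolding \<rho>_def ratio_def by (simp add: zero_ereal_def)
  \<comment> \<open>The supremum may be infinite for finitely many \<open>n\<close>, which no limit sees.\<close>
  have "\<forall>\<^sub>F n in sequentially. ratio n < \<infinity>"
    using order_tendstoD(2)[OF lim, of \<infinity>] unfolding ratio_def by simp
  then have bounds: "\<forall>\<^sub>F n in sequentially. n > 0 \<and> \<rho> n \<ge> 0 \<and> prob (bad n) \<le> 8 * \<rho> n \<and>
      (\<forall>\<eta>>0. prob {\<omega> \<in> space M. \<bar>T n \<omega> - W n \<omega>\<bar> > \<eta>} \<le> 8 * \<rho> n + 6 * sqrt (\<rho> n) / \<eta>) \<and>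
      (\<forall>C>0. prob {\<omega> \<in> space M. \<bar>W n \<omega>\<bar> > C} \<le> 1 / C\<^sup>2)"
    using eventually_gt_at_top[of 0]
  proof eventually_elim
    case (elim n)
    have "real n / real (m n) > 0" using elim m[of n] by simp
    then obtain K where K: "\<And>x. x \<in> space P \<Longrightarrow> leverage P (m n) (h n) x \<le> K"
      "ratio n = ereal (K / (real n / real (m n)))"
      using P.real_bound_of_ereal_SUP[of "real n / real (m n)" "leverage P (m n) (h n)"] elim
      unfolding ratio_def by blast
    have \<rho>: "\<rho> n = K * real (m n) / real n" by (simp add: \<rho>_def K(2))
    interpret S: bounded_leverage_sample M P "X n" n "m n" "h n" "f n" K
      by standard (use elim indep dist m h_L2 h_mean h_indep f_L2 sd[of n] K(1) in \<open>auto simp: \<sigma>_def\<close>)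
    note b = S.finite_sample_bounds[folded \<rho>]
    have "0 \<le> \<rho> n" using b(1) measure_nonneg[of M] by (smt (verit))
    then show ?case
      using b elim
      by (auto simp: bad_def T_def W_def \<sigma>_def \<mu>hat_def \<mu>_def \<epsilon>_def)
  qed
  have X: "X n i \<in> M \<rightarrow>\<^sub>M P" if "i < n" for n i
    using indep[of n] that by (auto simp: indep_vars_def)
  have h_meas: "h n j \<in> borel_measurable P" if "j < m n" for n j
    using h_L2[OF that] by (simp add: L2_def)
  have f_meas: "f n \<in> borel_measurable P" for n
    using f_L2 by (simp add: L2_def)
  have \<mu>hat_meas [measurable]: "\<mu>hat n \<in> borel_measurable M" for n
    unfolding \<mu>hat_def by (rule measurable_olsmc(1)[OF X h_meas f_meas])
  have wd_sets: "{\<omega> \<in> space M. olsmc_well_defined n (m n) (h n) (f n) (\<lambda>i. X n i \<omega>)} \<in> sets M" for n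
    by (rule measurable_olsmc(2)[OF X h_meas f_meas])
  have T_meas [measurable]: "T n \<in> borel_measurable M" for n
    unfolding T_def by measurable
  have W_meas [measurable]: "W n \<in> borel_measurable M" for n
  proof -
    have "\<epsilon> n \<in> borel_measurable P"
      using P.resid_properties(1)[OF h_L2 h_mean h_indep f_L2] by (simp add: \<epsilon>_def L2_def)
    then have "(\<lambda>\<omega>. emp_mean n (\<lambda>i. X n i \<omega>) (\<epsilon> n)) \<in> borel_measurable M"
      by (rule measurable_emp_mean[rotated]) (rule X)
    then show ?thesis unfolding W_def by measurable
  qed
  have bound_lim: "(\<lambda>n. 8 * \<rho> n + 6 * sqrt (\<rho> n) / \<eta>) \<longlonglongrightarrow> 0" if "\<eta> > 0" for \<eta>
    using \<rho>_lim that by (auto intro!: tendsto_eq_intros)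

  have "(\<lambda>n. prob (bad n)) \<longlonglongrightarrow> 0"
  proof (rule tendsto_sandwich[OF _ _ tendsto_const])
    show "\<forall>\<^sub>F n in sequentially. prob (bad n) \<le> 8 * \<rho> n"
      using bounds by eventually_elim auto
    show "(\<lambda>n. 8 * \<rho> n) \<longlonglongrightarrow> 0" using tendsto_mult_right[OF \<rho>_lim, of 8] by simp
  qed auto
  then have "(\<lambda>n. 1 - prob (bad n)) \<longlonglongrightarrow> 1 - 0"
    by (intro tendsto_diff tendsto_const)
  moreover have "1 - prob (bad n)
      = prob {\<omega> \<in> space M. olsmc_well_defined n (m n) (h n) (f n) (\<lambda>i. X n i \<omega>)}" for n
  proof -
    have "bad n = space M - {\<omega> \<in> space M. olsmc_well_defined n (m n) (h n) (f n) (\<lambda>i. X n i \<omega>)}"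
      by (auto simp: bad_def)
    then show ?thesis using prob_compl[OF wd_sets[of n]] by simp
  qed
  ultimately have well_defined: "(\<lambda>n. prob {\<omega> \<in> space M.
      olsmc_well_defined n (m n) (h n) (f n) (\<lambda>i. X n i \<omega>)}) \<longlonglongrightarrow> 1"
    by simp

  have TW_lim: "(\<lambda>n. prob {\<omega> \<in> space M. \<bar>T n \<omega> - W n \<omega>\<bar> > \<eta>}) \<longlonglongrightarrow> 0" if "\<eta> > 0" for \<eta>
  proof (rule tendsto_sandwich[OF _ _ tendsto_const bound_lim[OF that]])
    show "\<forall>\<^sub>F n in sequentially.
        prob {\<omega> \<in> space M. \<bar>T n \<omega> - W n \<omega>\<bar> > \<eta>} \<le> 8 * \<rho> n + 6 * sqrt (\<rho> n) / \<eta>"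
      using bounds by eventually_elim (use that in auto)
  qed auto
  have linearization: "little_oP M (\<lambda>n \<omega>. T n \<omega> - W n \<omega>) (\<lambda>_. 1)"
    unfolding little_oP_def using TW_lim by auto

  have tight: "\<exists>C. \<forall>\<^sub>F n in sequentially. prob {\<omega> \<in> space M. \<bar>T n \<omega>\<bar> > C} < \<delta>" if \<delta>: "\<delta> > 0" for \<delta>
  proof -
    \<comment> \<open>Chebyshev leaves mass at most \<open>1 / C\<^sup>2 = \<delta> / 2\<close> beyond \<open>C\<close>, and the extra 1 pays for the linearization error.\<close>
    define C where "C = sqrt (2 / \<delta>)"
    have C: "C > 0" "1 / C\<^sup>2 = \<delta> / 2" using \<delta> by (simp_all add: C_def)
    have "\<forall>\<^sub>F n in sequentially. prob {\<omega> \<in> space M. \<bar>T n \<omega> - W n \<omega>\<bar> > 1} < \<delta> / 2"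
      using order_tendstoD(2)[OF TW_lim[of 1], of "\<delta> / 2"] \<delta> by simp
    with bounds have "\<forall>\<^sub>F n in sequentially. prob {\<omega> \<in> space M. \<bar>T n \<omega>\<bar> > C + 1} < \<delta>"
    proof eventually_elim
      case (elim n)
      have "prob {\<omega> \<in> space M. \<bar>T n \<omega>\<bar> > C + 1}
          \<le> prob ({\<omega> \<in> space M. \<bar>T n \<omega> - W n \<omega>\<bar> > 1} \<union> {\<omega> \<in> space M. \<bar>W n \<omega>\<bar> > C})"
        by (rule finite_measure_mono) auto
      also have "\<dots> \<le> prob {\<omega> \<in> space M. \<bar>T n \<omega> - W n \<omega>\<bar> > 1} + prob {\<omega> \<in> space M. \<bar>W n \<omega>\<bar> > C}"
        by (rule measure_Un_le) measurable
      also have "prob {\<omega> \<in> space M. \<bar>W n \<omega>\<bar> > C} \<le> \<delta> / 2"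
        using elim C by metis
      finally show ?case using elim by linarith
    qed
    then show ?thesis by blast
  qed
  then have scaled_bounded: "big_OP M T (\<lambda>_. 1)"
    unfolding big_OP_def by simp

  have "big_OP M (\<lambda>n \<omega>. \<mu>hat n \<omega> - \<mu> n) (\<lambda>n. \<sigma> n / sqrt (real n))"
    unfolding big_OP_def
  proof (intro conjI allI impI)
    show "(\<lambda>\<omega>. \<mu>hat n \<omega> - \<mu> n) \<in> borel_measurable M" for n by measurable
    fix \<delta> :: real assume "\<delta> > 0"
    then obtain C where "\<forall>\<^sub>F n in sequentially. prob {\<omega> \<in> space M. \<bar>T n \<omega>\<bar> > C} < \<delta>"
      using tight by blast
    then have "\<forall>\<^sub>F n in sequentially.
        prob {\<omega> \<in> space M. \<bar>\<mu>hat n \<omega> - \<mu> n\<bar> > C * \<bar>\<sigma> n / sqrt (real n)\<bar>} < \<delta>"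
      using eventually_gt_at_top[of 0]
    proof eventually_elim
      case (elim n)
      have t: "\<sigma> n / sqrt (real n) > 0" using sd[of n] elim(2) by simp
      have "\<bar>T n \<omega>\<bar> = \<bar>\<mu>hat n \<omega> - \<mu> n\<bar> / (\<sigma> n / sqrt (real n))" for \<omega>
        using sd[of n] by (simp add: T_def abs_mult)
      then have "\<bar>T n \<omega>\<bar> > C \<longleftrightarrow> \<bar>\<mu>hat n \<omega> - \<mu> n\<bar> > C * \<bar>\<sigma> n / sqrt (real n)\<bar>" for \<omega>
        by (simp only: pos_less_divide_eq[OF t] abs_of_pos[OF t])
      then show ?case using elim(1) by simp
    qed
    then show "\<exists>C. \<forall>\<^sub>F n in sequentially.
        prob {\<omega> \<in> space M. \<bar>\<mu>hat n \<omega> - \<mu> n\<bar> > C * \<bar>\<sigma> n / sqrt (real n)\<bar>} < \<delta>" by blast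
  qed
  then show ?thesis
    using well_defined linearization scaled_bounded
    unfolding T_def[abs_def] W_def[abs_def] by blast
qed

end
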